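(* Let $\nu>0$, $\lambda>0$, $\alpha>0$. Let $f\in C(\mathbb R,\ell_2)$ be translation-compact (i.e. $\{f^h : h\in\mathbb R\}$ is precompact in $C(\mathbb R,\ell_2)$), and let $F\in C(\mathbb R,\mathbb R)$ be Lipschitz continuous on bounded sets with $F(0)=0$ and $sF(s)\le -\alpha s^2$ for all $s\in\mathbb R$. Let $\langle \ell_2,\varphi,(H(f),\mathbb R,\sigma)\rangle$ be the cocycle generated by the equation $$u'=\nu\Lambda u-\lambda u+\widetilde F(u)+f(t)$$ in $\ell_2$. Then this cocycle has a compact global attractor $\{I_g : g\in H(f)\}$.
   Context: $\ell_2$ is the Hilbert space of real two-sided square-summable sequences $u=(u_i)_{i\in\mathbb Z}$ with norm $\|\cdot\|$. $(\Lambda u)_i:=u_{i-1}-2u_i+u_{i+1}$ (a bounded linear operator on $\ell_2$) and $\widetilde F(u)_i:=F(u_i)$ (which maps $\ell_2$ to $\ell_2$ when $F(0)=0$ and $F$ is Lipschitz on bounded sets). $C(\mathbb R,\ell_2)$ is the space of continuous functions $\mathbb R\to\ell_2$ with the compact-open topology (uniform convergence on compact intervals), metrized by $d(f_1,f_2)=\sup_{L>0}\min\{\max_{|t|\le L}\|f_1(t)-f_2(t)\|,L^{-1}\}$. $f^h(t):=f(t+h)$; $H(f)$ is the closure of $\{f^h: h\in\mathbb R\}$ in $C(\mathbb R,\ell_2)$; $\sigma(h,g):=g^h$ is the shift dynamical system on $H(f)$. For $(v,g)\in\ell_2\times H(f)$, $\varphi(t,v,g)$ ($t\ge0$) denotes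 the unique solution, defined on $[0,+\infty)$, of $u'=\nu\Lambda u-\lambda u+\widetilde F(u)+g(t)$, $u(0)=v$. The map $\varphi:\mathbb R_+\times\ell_2\times H(f)\to\ell_2$ is the cocycle generated by the equation: it is continuous, $\varphi(0,v,g)=v$ and $\varphi(t+\tau,v,g)=\varphi(t,\varphi(\tau,v,g),g^\tau)$. For subsets $A,B\subset\ell_2$, $\beta(A,B):=\sup_{a\in A}\inf_{b\in B}\|a-b\|$ (with $\inf\emptyset=+\infty$). With $Y=H(f)$, a family $\{I_y : y\in Y\}$ of compact subsets of $\ell_2$ is a compact global attractor of the cocycle $\varphi$ if: (1) $\mathcal I:=\bigcup_{y\in Y}I_y$ is precompact; (2) $\varphi(t,I_y,y)=I_{\sigma(t,y)}$ for all $(t,y)\in\mathbb R_+\times Y$; (3) $\lim_{t\to+\infty}\sup_{y\in Y}\beta(\varphi(t,M,y),\mathcal I)=0$ for every compact subset $M\subset\ell_2$. *)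

theory Defs
  imports "HOL-Analysis.Analysis"
begin

section \<open>The Hilbert space of two-sided square-summable real sequences\<close>

typedef ell2 = "{u :: int \<Rightarrow> real. (\<lambda>i. (u i)\<^sup>2) summable_on UNIV}"
  morphisms coord Abs_ell2
  by (rule exI[of _ "\<lambda>_. 0"]) simp

setup_lifting type_definition_ell2

lemma sq_summable_mult:
  fixes u v :: "int \<Rightarrow> real"
  assumes "(\<lambda>i. (u i)\<^sup>2) summable_on UNIV" "(\<lambda>i. (v i)\<^sup>2) summable_on UNIV"
  shows "(\<lambda>i. u i * v i) summable_on UNIV"
proof -
  have "(\<lambda>i. (u i)\<^sup>2 + (v i)\<^sup>2) summable_on UNIV"
    using assms by (rule summable_on_add)
  moreover have "norm (u i * v i) \<le> (u i)\<^sup>2 + (v i)\<^sup>2" for i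
  proof -
    have "0 \<le> (\<bar>u i\<bar> - \<bar>v i\<bar>)\<^sup>2"
      by simp
    then have "2 * (\<bar>u i\<bar> * \<bar>v i\<bar>) \<le> (u i)\<^sup>2 + (v i)\<^sup>2"
      by (simp add: power2_diff)
    moreover have "0 \<le> \<bar>u i\<bar> * \<bar>v i\<bar>"
      by simp
    ultimately have "\<bar>u i\<bar> * \<bar>v i\<bar> \<le> (u i)\<^sup>2 + (v i)\<^sup>2"
      by linarith
    then show ?thesis
      by (simp add: abs_mult)
  qed
  ultimately have "(\<lambda>i. norm (u i * v i)) summable_on UNIV"
    by (rule summable_on_comparison_test) auto
  then show ?thesis
    by (rule abs_summable_summable)
qed

lemma sq_summable_add:
  fixes u v :: "int \<Rightarrow> real"
  assumes "(\<lambda>i. (u i)\<^sup>2) summable_on UNIV" "(\<lambda>i. (v i)\<^sup>2) summable_on UNIV"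
  shows "(\<lambda>i. (u i + v i)\<^sup>2) summable_on UNIV"
proof -
  have "(\<lambda>i. (u i)\<^sup>2 + (v i)\<^sup>2 + 2 * (u i * v i)) summable_on UNIV"
    by (intro summable_on_add summable_on_cmult_right assms sq_summable_mult)
  then show ?thesis
    by (simp add: power2_sum mult.assoc)
qed

lemma sq_summable_scale:
  fixes u :: "int \<Rightarrow> real"
  assumes "(\<lambda>i. (u i)\<^sup>2) summable_on UNIV"
  shows "(\<lambda>i. (c * u i)\<^sup>2) summable_on UNIV"
  using summable_on_cmult_right[OF assms, of "c\<^sup>2"] by (simp add: power_mult_distrib)

lemma sq_summable_shift:
  fixes u :: "int \<Rightarrow> real"
  assumes "(\<lambda>i. (u i)\<^sup>2) summable_on UNIV"
  shows "(\<lambda>i. (u (i + k))\<^sup>2) summable_on UNIV"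
proof -
  have "bij (\<lambda>i::int. i + k)"
    by (rule bij_betwI[where g = "\<lambda>i. i - k"]) auto
  from summable_on_reindex_bij_betw[OF this, of "\<lambda>i. (u i)\<^sup>2"] assms show ?thesis
    by simp
qed

instantiation ell2 :: real_inner
begin

lift_definition zero_ell2 :: ell2 is "\<lambda>_. 0"
  by simp

lift_definition plus_ell2 :: "ell2 \<Rightarrow> ell2 \<Rightarrow> ell2" is "\<lambda>u v i. u i + v i"
  by (rule sq_summable_add)

lift_definition uminus_ell2 :: "ell2 \<Rightarrow> ell2" is "\<lambda>u i. - u i"
  by simp

lift_definition scaleR_ell2 :: "real \<Rightarrow> ell2 \<Rightarrow> ell2" is "\<lambda>c u i. c * u i"
  by (rule sq_summable_scale)

definition minus_ell2 :: "ell2 \<Rightarrow> ell2 \<Rightarrow> ell2"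
  where "minus_ell2 u v = u + - v"

lift_definition inner_ell2 :: "ell2 \<Rightarrow> ell2 \<Rightarrow> real" is "\<lambda>u v. \<Sum>\<^sub>\<infinity>i. u i * v i" .

definition norm_ell2 :: "ell2 \<Rightarrow> real"
  where "norm_ell2 u = sqrt (inner u u)"

definition dist_ell2 :: "ell2 \<Rightarrow> ell2 \<Rightarrow> real"
  where "dist_ell2 u v = norm (u - v)"

definition sgn_ell2 :: "ell2 \<Rightarrow> ell2"
  where "sgn_ell2 u = inverse (norm u) *\<^sub>R u"

definition uniformity_ell2 :: "(ell2 \<times> ell2) filter"
  where "uniformity_ell2 = (INF e\<in>{0 <..}. principal {(u, v). dist u v < e})"

definition open_ell2 :: "ell2 set \<Rightarrow> bool"
  where "open_ell2 S = (\<forall>u\<in>S. \<forall>\<^sub>F (u', v) in uniformity. u' = u \<longrightarrow> v \<in> S)"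

instance
proof
  fix u v w :: ell2 and a b :: real
  show "u + v + w = u + (v + w)"
    by transfer (simp add: add.assoc)
  show "u + v = v + u"
    by transfer (simp add: add.commute)
  show "0 + u = u"
    by transfer simp
  show "- u + u = 0"
    by transfer simp
  show "u - v = u + - v"
    by (rule minus_ell2_def)
  show "a *\<^sub>R (u + v) = a *\<^sub>R u + a *\<^sub>R v"
    by transfer (simp add: algebra_simps)
  show "(a + b) *\<^sub>R u = a *\<^sub>R u + b *\<^sub>R u"
    by transfer (simp add: algebra_simps)
  show "a *\<^sub>R b *\<^sub>R u = (a * b) *\<^sub>R u"
    by transfer (simp add: algebra_simps)
  show "1 *\<^sub>R u = u"
    by transfer simp
  show "inner u v = inner v u"
    by transfer (simp add: mult.commute)
  show "inner (u + v) w = inner u w + inner v w"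
    by transfer (simp add: distrib_right infsum_add sq_summable_mult)
  show "inner (a *\<^sub>R u) v = a * inner u v"
    by transfer (simp add: mult.assoc infsum_cmult_right')
  show "0 \<le> inner u u"
    by transfer (simp add: infsum_nonneg)
  show "inner u u = 0 \<longleftrightarrow> u = 0"
  proof transfer
    fix u :: "int \<Rightarrow> real"
    assume u: "(\<lambda>i. (u i)\<^sup>2) summable_on UNIV"
    show "(\<Sum>\<^sub>\<infinity>i. u i * u i) = 0 \<longleftrightarrow> u = (\<lambda>_. 0)"
    proof
      assume "(\<Sum>\<^sub>\<infinity>i. u i * u i) = 0"
      then have "u i * u i = 0" for i
        by (intro nonneg_infsum_le_0D[of "\<lambda>i. u i * u i" UNIV]) (use u in \<open>simp_all add: power2_eq_square\<close>)
      then show "u = (\<lambda>_. 0)"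
        by auto
    qed simp
  qed
qed (rule norm_ell2_def dist_ell2_def sgn_ell2_def uniformity_ell2_def open_ell2_def)+

end

lemma coord_minus [simp]: "coord (u - v) i = coord u i - coord v i"
  unfolding minus_ell2_def plus_ell2.rep_eq uminus_ell2.rep_eq by simp

lemma norm_ell2_sq: "(norm u)\<^sup>2 = (\<Sum>\<^sub>\<infinity>i. (coord u i)\<^sup>2)"
  unfolding power2_norm_eq_inner inner_ell2.rep_eq by (simp add: power2_eq_square)

lemma coord_sq_summable: "(\<lambda>i. (coord u i)\<^sup>2) summable_on UNIV"
  using coord[of u] by simp

lemma sum_coord_sq_le:
  assumes "finite A"
  shows "(\<Sum>i\<in>A. (coord u i)\<^sup>2) \<le> (norm u)\<^sup>2"
  unfolding norm_ell2_sq by (rule finite_sum_le_infsum) (use assms coord_sq_summable in auto)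

lemma abs_coord_le: "\<bar>coord u i\<bar> \<le> norm u"
  using sum_coord_sq_le[of "{i}" u] by (simp add: abs_le_square_iff[symmetric])

instance ell2 :: complete_space
proof
  fix X :: "nat \<Rightarrow> ell2"
  assume X: "Cauchy X"
  have "Cauchy (\<lambda>n. coord (X n) i)" for i
  proof (rule metric_CauchyI)
    fix e :: real
    assume "0 < e"
    then obtain N where N: "\<And>m n. m \<ge> N \<Longrightarrow> n \<ge> N \<Longrightarrow> dist (X m) (X n) < e"
      using metric_CauchyD[OF X, of e] by blast
    have "dist (coord (X m) i) (coord (X n) i) < e" if "m \<ge> N" "n \<ge> N" for m n
      using abs_coord_le[of "X m - X n" i] N[OF that] by (simp add: dist_norm)
    then show "\<exists>M. \<forall>m\<ge>M. \<forall>n\<ge>M. dist (coord (X m) i) (coord (X n) i) < e"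
      by blast
  qed
  then have "(\<lambda>n. coord (X n) i) \<longlonglongrightarrow> lim (\<lambda>n. coord (X n) i)" for i
    by (simp add: Cauchy_convergent convergent_LIMSEQ_iff[symmetric])
  then obtain l where l: "\<And>i. (\<lambda>n. coord (X n) i) \<longlonglongrightarrow> l i"
    by (rule that)
  have fin: "(\<Sum>i\<in>A. (coord (X m) i - l i)\<^sup>2) \<le> e\<^sup>2"
    if "finite A" "\<And>n. n \<ge> N \<Longrightarrow> dist (X m) (X n) < e" for A m N e
  proof (rule LIMSEQ_le_const2)
    show "(\<lambda>n. \<Sum>i\<in>A. (coord (X m) i - coord (X n) i)\<^sup>2) \<longlonglongrightarrow> (\<Sum>i\<in>A. (coord (X m) i - l i)\<^sup>2)"
      by (intro tendsto_intros l)
    have "(\<Sum>i\<in>A. (coord (X m) i - coord (X n) i)\<^sup>2) \<le> e\<^sup>2" if "n \<ge> N" for n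
    proof -
      have "(\<Sum>i\<in>A. (coord (X m) i - coord (X n) i)\<^sup>2) \<le> (norm (X m - X n))\<^sup>2"
        using sum_coord_sq_le[OF \<open>finite A\<close>, of "X m - X n"] by simp
      also have "\<dots> \<le> e\<^sup>2"
        using \<open>n \<ge> N \<Longrightarrow> dist (X m) (X n) < e\<close>[OF that]
        by (intro power_mono) (auto simp: dist_norm)
      finally show ?thesis .
    qed
    then show "\<exists>N. \<forall>n\<ge>N. (\<Sum>i\<in>A. (coord (X m) i - coord (X n) i)\<^sup>2) \<le> e\<^sup>2"
      by blast
  qed
  have summ: "(\<lambda>i. (coord (X m) i - l i)\<^sup>2) summable_on UNIV"
    if "\<And>n. n \<ge> N \<Longrightarrow> dist (X m) (X n) < e" for m N e
    by (rule nonneg_bdd_above_summable_on) (use fin[OF _ that] in \<open>auto intro!: bdd_aboveI2\<close>)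
  obtain N where N: "\<And>m n. m \<ge> N \<Longrightarrow> n \<ge> N \<Longrightarrow> dist (X m) (X n) < 1"
    using metric_CauchyD[OF X zero_less_one] by blast
  have "(\<lambda>i. (coord (X N) i + - 1 * (coord (X N) i - l i))\<^sup>2) summable_on UNIV"
    by (intro sq_summable_add sq_summable_scale coord_sq_summable summ[of N N 1] N) auto
  then have lsum: "(\<lambda>i. (l i)\<^sup>2) summable_on UNIV"
    by simp
  define L where "L = Abs_ell2 l"
  have L: "coord L i = l i" for i
    unfolding L_def using lsum by (simp add: Abs_ell2_inverse)
  have "X \<longlonglongrightarrow> L"
  proof (rule metric_LIMSEQ_I)
    fix e :: real
    assume e: "0 < e"
    obtain M where M: "\<And>m n. m \<ge> M \<Longrightarrow> n \<ge> M \<Longrightarrow> dist (X m) (X n) < e / 2"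
      using metric_CauchyD[OF X half_gt_zero[OF e]] by blast
    have "dist (X m) L < e" if "m \<ge> M" for m
    proof -
      have "(norm (X m - L))\<^sup>2 \<le> (e / 2)\<^sup>2"
        unfolding norm_ell2_sq coord_minus L
        by (rule infsum_le_finite_sums[OF summ[OF M[OF that]] fin[OF _ M[OF that]]])
      then have "norm (X m - L) \<le> e / 2"
        by (rule power2_le_imp_le) (use e in simp)
      then show ?thesis
        using e by (simp add: dist_norm)
    qed
    then show "\<exists>no. \<forall>n\<ge>no. dist (X n) L < e"
      by blast
  qed
  then show "convergent X"
    by (auto simp: convergent_def)
qed

section \<open>Continuous curves with the compact-open topology\<close>

typedef (overloaded) 'a curve = "{f :: real \<Rightarrow> 'a :: metric_space. continuous_on UNIV f}"
  morphisms at_time Curve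
  by (rule exI[of _ "\<lambda>_. undefined"]) simp

setup_lifting type_definition_curve

lemma continuous_on_at_time [continuous_intros]: "continuous_on T (at_time f)"
  using at_time[of f] by (auto intro: continuous_on_subset)

lemma bdd_above_dist_at_time:
  "bdd_above ((\<lambda>t. dist (at_time f t) (at_time g t)) ` {- L..L})"
  by (intro bounded_imp_bdd_above compact_imp_bounded compact_continuous_image
      continuous_intros compact_Icc)

instantiation curve :: (metric_space) metric_space
begin

definition dist_curve :: "'a curve \<Rightarrow> 'a curve \<Rightarrow> real"
  where "dist_curve f g =
    (SUP L\<in>{0<..}. min (SUP t\<in>{- L..L}. dist (at_time f t) (at_time g t)) (inverse L))"

definition uniformity_curve :: "('a curve \<times> 'a curve) filter"
  where "uniformity_curve = (INF e\<in>{0 <..}. principal {(f, g). dist f g < e})"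

definition open_curve :: "'a curve set \<Rightarrow> bool"
  where "open_curve S = (\<forall>f\<in>S. \<forall>\<^sub>F (f', g) in uniformity. f' = f \<longrightarrow> g \<in> S)"

lemma le_SUP_dist_at_time:
  assumes "\<bar>t\<bar> \<le> L"
  shows "dist (at_time f t) (at_time g t) \<le> (SUP t\<in>{- L..L}. dist (at_time f t) (at_time g t))"
  using assms by (intro cSUP_upper bdd_above_dist_at_time) auto

lemma le_dist_curve:
  fixes f g :: "'a curve"
  assumes "0 < L"
  shows "min (SUP t\<in>{- L..L}. dist (at_time f t) (at_time g t)) (inverse L) \<le> dist f g"
proof -
  let ?m = "\<lambda>L. SUP t\<in>{- L..L}. dist (at_time f t) (at_time g t)"
  have "min (?m L) (inverse L) \<le> max (?m 1) 1" if "L > 0" for L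
  proof (cases "L \<le> 1")
    case True
    have "?m L \<le> ?m 1"
      by (rule cSUP_subset_mono) (use True that bdd_above_dist_at_time in auto)
    then show ?thesis
      by linarith
  next
    case False
    then have "inverse L \<le> 1"
      by (simp add: inverse_le_1_iff)
    then show ?thesis
      by linarith
  qed
  then have "bdd_above ((\<lambda>L. min (?m L) (inverse L)) ` {0<..})"
    by (intro bdd_aboveI2[where M = "max (?m 1) 1"]) auto
  then show ?thesis
    unfolding dist_curve_def using assms by (intro cSUP_upper) auto
qed

instance
proof
  fix f g h :: "'a curve"
  let ?m = "\<lambda>f g L. SUP t\<in>{- L..L}. dist (at_time f t) (at_time g t)"
  show "dist f g = 0 \<longleftrightarrow> f = g"
  proof
    assume 0: "dist f g = 0"
    have "at_time f t = at_time g t" for t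
    proof -
      define L where "L = \<bar>t\<bar> + 1"
      have L: "L > 0"
        by (simp add: L_def)
      then have "?m f g L \<le> 0"
        using le_dist_curve[of L f g] 0 by (auto simp: min_def split: if_splits)
      moreover have "dist (at_time f t) (at_time g t) \<le> ?m f g L"
        by (rule le_SUP_dist_at_time) (simp add: L_def)
      ultimately have "dist (at_time f t) (at_time g t) \<le> 0"
        by linarith
      then show ?thesis
        by simp
    qed
    then show "f = g"
      by (auto simp: at_time_inject[symmetric])
  next
    assume "f = g"
    moreover have "min (?m g g L) (inverse L) = 0" if "L > 0" for L
      using that by simp
    ultimately show "dist f g = 0"
      unfolding dist_curve_def by simp
  qed
  show "dist f g \<le> dist f h + dist g h"
  proof -
    have "min (?m f g L) (inverse L) \<le> dist f h + dist g h" if L: "L > 0" for L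
    proof -
      have "?m f g L \<le> ?m f h L + ?m g h L"
      proof (rule cSUP_least)
        fix t
        assume "t \<in> {- L..L}"
        then have "\<bar>t\<bar> \<le> L"
          by auto
        then show "dist (at_time f t) (at_time g t) \<le> ?m f h L + ?m g h L"
          using dist_triangle2[of "at_time f t" "at_time g t" "at_time h t"]
            le_SUP_dist_at_time[of t L f h] le_SUP_dist_at_time[of t L g h] by linarith
      qed (use L in auto)
      moreover have "0 \<le> ?m f h L" "0 \<le> ?m g h L"
        using le_SUP_dist_at_time[of 0 L] L by (auto intro: order_trans[OF zero_le_dist])
      moreover have "0 < inverse L"
        using L by simp
      ultimately show ?thesis
        using le_dist_curve[OF L, of f h] le_dist_curve[OF L, of g h] by linarith
    qed
    then show ?thesis
      unfolding dist_curve_def[of f g] by (intro cSUP_least) auto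
  qed
qed (rule open_curve_def uniformity_curve_def)+

end

lift_definition shift :: "real \<Rightarrow> 'a::metric_space curve \<Rightarrow> 'a curve" is "\<lambda>h f t. f (t + h)"
  by (rule continuous_on_compose2[of UNIV]) (auto intro: continuous_on_add continuous_on_id continuous_on_const)

definition curve_hull :: "'a::metric_space curve \<Rightarrow> 'a curve set"
  where "curve_hull f = closure (range (\<lambda>h. shift h f))"

definition precompact :: "'a::topological_space set \<Rightarrow> bool"
  where "precompact S \<longleftrightarrow> compact (closure S)"

definition translation_compact :: "'a::metric_space curve \<Rightarrow> bool"
  where "translation_compact f \<longleftrightarrow> precompact (range (\<lambda>h. shift h f))"

section \<open>The lattice equation and its cocycle\<close>

lift_definition laplacian :: "ell2 \<Rightarrow> ell2" is "\<lambda>u i. u (i - 1) - 2 * u i + u (i + 1)"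
proof -
  fix u :: "int \<Rightarrow> real"
  assume u: "(\<lambda>i. (u i)\<^sup>2) summable_on UNIV"
  have "(\<lambda>i. (u (i + - 1) + - 2 * u i + u (i + 1))\<^sup>2) summable_on UNIV"
    by (intro sq_summable_add sq_summable_scale sq_summable_shift u)
  then show "(\<lambda>i. (u (i - 1) - 2 * u i + u (i + 1))\<^sup>2) summable_on UNIV"
    by simp
qed

text \<open>The superposition operator has the coordinates \<open>F (coord u i)\<close> only when these are
  square-summable, which is the case for every \<open>u\<close> if \<open>F 0 = 0\<close> and \<open>F\<close> is Lipschitz on bounded sets.\<close>

definition superposition :: "(real \<Rightarrow> real) \<Rightarrow> ell2 \<Rightarrow> ell2"
  where "superposition F u = Abs_ell2 (\<lambda>i. F (coord u i))"

lemma coord_superposition: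
  assumes F0: "F 0 = 0" and lip: "\<And>B. bounded B \<Longrightarrow> \<exists>K. K-lipschitz_on B F"
  shows "coord (superposition F u) i = F (coord u i)"
proof -
  obtain K where K: "K-lipschitz_on (cball 0 (norm u)) F"
    using lip bounded_cball by blast
  have "(F (coord u i))\<^sup>2 \<le> K\<^sup>2 * (coord u i)\<^sup>2" for i
  proof -
    have "dist (F (coord u i)) (F 0) \<le> K * dist (coord u i) 0"
      by (rule lipschitz_onD[OF K]) (use abs_coord_le[of u i] in auto)
    then have "\<bar>F (coord u i)\<bar> \<le> K * \<bar>coord u i\<bar>"
      by (simp add: F0)
    then have "\<bar>F (coord u i)\<bar>\<^sup>2 \<le> (K * \<bar>coord u i\<bar>)\<^sup>2"
      by (rule power_mono) simp
    then show ?thesis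
      by (simp add: power_mult_distrib)
  qed
  then have "(\<lambda>i. (F (coord u i))\<^sup>2) summable_on UNIV"
    by (intro summable_on_comparison_test[OF summable_on_cmult_right[OF coord_sq_summable]]) auto
  then show ?thesis
    by (simp add: superposition_def Abs_ell2_inverse)
qed

definition lattice_solution ::
    "real \<Rightarrow> real \<Rightarrow> (real \<Rightarrow> real) \<Rightarrow> ell2 \<Rightarrow> ell2 curve \<Rightarrow> (real \<Rightarrow> ell2) \<Rightarrow> bool"
  where "lattice_solution \<nu> lam F v g u \<longleftrightarrow> u 0 = v \<and>
    (\<forall>t\<ge>0. (u has_vector_derivative
      \<nu> *\<^sub>R laplacian (u t) - lam *\<^sub>R u t + superposition F (u t) + at_time g t) (at t within {0..}))"

text \<open>Functions being total, a solution is determined only on \<open>{0..}\<close>; hence the description ranges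
  over the value at time \<open>t \<ge> 0\<close> and not over the solution itself.\<close>

definition lattice_cocycle ::
    "real \<Rightarrow> real \<Rightarrow> (real \<Rightarrow> real) \<Rightarrow> real \<Rightarrow> ell2 \<Rightarrow> ell2 curve \<Rightarrow> ell2"
  where "lattice_cocycle \<nu> lam F t v g = (THE x. \<exists>u. lattice_solution \<nu> lam F v g u \<and> u t = x)"

section \<open>Compact global attractors\<close>

text \<open>The values are extended nonnegative reals, so that the supremum over the empty set is 0
  and the infimum over the empty set is \<open>\<infinity>\<close>.\<close>

definition semidist :: "'a::metric_space set \<Rightarrow> 'a set \<Rightarrow> ennreal"
  where "semidist A B = (SUP a\<in>A. INF b\<in>B. ennreal (dist a b))"

definition compact_global_attractor ::
    "(real \<Rightarrow> 'x::metric_space \<Rightarrow> 'y \<Rightarrow> 'x) \<Rightarrow> 'y set \<Rightarrow> (real \<Rightarrow> 'y \<Rightarrow> 'y) \<Rightarrow> ('y \<Rightarrow> 'x set) \<Rightarrow> bool"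
  where "compact_global_attractor \<phi> Y \<sigma> I \<longleftrightarrow>
    (\<forall>y\<in>Y. compact (I y)) \<and>
    precompact (\<Union>y\<in>Y. I y) \<and>
    (\<forall>t\<ge>0. \<forall>y\<in>Y. (\<lambda>x. \<phi> t x y) ` I y = I (\<sigma> t y)) \<and>
    (\<forall>M. compact M \<longrightarrow>
      ((\<lambda>t. SUP y\<in>Y. semidist ((\<lambda>x. \<phi> t x y) ` M) (\<Union>y\<in>Y. I y)) \<longlongrightarrow> 0) at_top)"

end

theory Submission
  imports Defs
begin

text \<open>Along solutions, every weighted energy \<open>\<Sum>i. \<theta> i * (u i)\<^sup>2\<close> with weights in \<open>[0, 1]\<close> decays at rate
  \<open>lam\<close> up to the forcing and a discrete Laplacian of the weight. Constant weight gives an absorbing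
  ball; weights vanishing near the origin with small slope \<open>\<eta>\<close> give smallness of tails, uniformly
  over the hull because the forcing takes values in one compact set. Bounded sets with uniformly small
  tails are precompact in \<open>\<ell>\<^sub>2\<close>. Hence trajectories from a compact set stay in a compact set, and all
  relatively compact complete trajectories lie in one compact set. The attractor over \<open>g\<close> is the set of
  present states of such trajectories, so its invariance is immediate, and a compactness argument in
  the space of backward orbits yields closedness and attraction.\<close>

section \<open>Attractors of asymptotically compact cocycles\<close>

text \<open>The vector field is locally Lipschitz on all of \<open>ell2\<close>, so the flow comes
  from an ordinary differential equation and smooths nothing. In infinite dimension a norm bound
  gives no compactness; what can be lost is mass moving off to large indices. The Laplacian is the
  only term that couples sites. Against a weight of slope \<eta> it costs at most 2 \<nu> \<eta>
  times the squared norm; the norm estimate bounds this, and the damping turns it into an error of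
  order \<eta> that is the same for all times. Attraction is asked only of compact sets and only
  towards the union of the fibres. This permits an indirect argument: a limit of pasts of longer and
  longer trajectories is a complete trajectory, over a limit forcing that the compact hull provides.
  The definition grants each complete trajectory only some compact set of its own; since its distant
  past is damped exponentially, one compact set nevertheless serves all of them.\<close>

lemma compact_sequence_space:
  fixes N :: "'a::topological_space set"
  assumes "compact N"
  shows "compact {c :: nat \<Rightarrow> 'a. \<forall>m. c m \<in> N}"
proof -
  have "compactin (product_topology (\<lambda>_::nat. euclidean) UNIV) (PiE UNIV (\<lambda>_. N))"
    using assms unfolding compactin_PiE by simp
  moreover have "PiE UNIV (\<lambda>_. N) = {c :: nat \<Rightarrow> 'a. \<forall>m. c m \<in> N}"
    by auto
  ultimately show ?thesis
    by (simp add: euclidean_product_topology)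
qed

text \<open>The algebra is kept apart from continuity and compactness because backward orbits must
  be available before the compactness assumptions, which speak of them, can be verified for the
  lattice. Backward time enters only through \<open>\<sigma>\<close>, a group action.\<close>

locale cocycle =
  fixes \<phi> :: "real \<Rightarrow> 'x::metric_space \<Rightarrow> 'y::metric_space \<Rightarrow> 'x"
    and Y :: "'y set" and \<sigma> :: "real \<Rightarrow> 'y \<Rightarrow> 'y"
  assumes flow_zero: "y \<in> Y \<Longrightarrow> \<sigma> 0 y = y"
    and flow_add: "y \<in> Y \<Longrightarrow> \<sigma> s (\<sigma> t y) = \<sigma> (s + t) y"
    and flow_in: "y \<in> Y \<Longrightarrow> \<sigma> t y \<in> Y"
    and cocycle_zero: "y \<in> Y \<Longrightarrow> \<phi> 0 x y = x"
    and cocycle_add: "y \<in> Y \<Longrightarrow> 0 \<le> s \<Longrightarrow> 0 \<le> t \<Longrightarrow> \<phi> (s + t) x y = \<phi> s (\<phi> t x y) (\<sigma> t y)"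
begin

text \<open>Complete trajectories are sampled at the times \<open>0, -1, -2, \<dots>\<close>: the space of orbits is then a
  countable product, hence metrizable, and the cocycle recovers all other times.\<close>

definition backward_orbit :: "'y \<Rightarrow> (nat \<Rightarrow> 'x) \<Rightarrow> bool"
  where "backward_orbit y c \<longleftrightarrow> (\<exists>N. compact N \<and> range c \<subseteq> N) \<and>
    (\<forall>m. \<phi> 1 (c (Suc m)) (\<sigma> (- real (Suc m)) y) = c m)"

text \<open>Moves the origin of time to \<open>- n\<close>, so that whatever is known of
  \<open>c 0\<close> for every orbit over every base point holds for \<open>c n\<close> as
  well.\<close>

lemma backward_orbit_tail:
  assumes y: "y \<in> Y" and c: "backward_orbit y c"
  shows "backward_orbit (\<sigma> (- real n) y) (\<lambda>m. c (m + n))"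
proof -
  have "\<sigma> (- real (Suc m)) (\<sigma> (- real n) y) = \<sigma> (- real (Suc (m + n))) y" for m
    using y by (simp add: flow_add algebra_simps)
  moreover obtain N where "compact N" "range c \<subseteq> N"
    using c unfolding backward_orbit_def by blast
  then have "\<exists>N. compact N \<and> range (\<lambda>m. c (m + n)) \<subseteq> N"
    by blast
  moreover have "\<phi> 1 (c (Suc (m + n))) (\<sigma> (- real (Suc (m + n))) y) = c (m + n)" for m
    using c unfolding backward_orbit_def by blast
  ultimately show ?thesis
    unfolding backward_orbit_def by simp
qed

lemma backward_orbit_apply:
  assumes y: "y \<in> Y" and c: "backward_orbit y c"
  shows "\<phi> (real n) (c n) (\<sigma> (- real n) y) = c 0"
proof (induction n)
  case 0
  then show ?case
    using y by (simp add: flow_zero cocycle_zero)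
next
  case (Suc n)
  let ?y = "\<sigma> (- real (Suc n)) y"
  have "\<phi> (real n + 1) (c (Suc n)) ?y = \<phi> (real n) (\<phi> 1 (c (Suc n)) ?y) (\<sigma> 1 ?y)"
    by (rule cocycle_add) (use y in \<open>auto intro: flow_in\<close>)
  also have "\<dots> = c 0"
    using c y Suc.IH by (simp add: backward_orbit_def flow_add)
  finally show ?case
    by (simp add: add.commute)
qed

end

text \<open>The last two assumptions stand in for smoothing. The set \<open>N\<close> may depend on
  \<open>M\<close>, whereas \<open>K\<close> is common to all orbits and all base points; it is
  \<open>K\<close> that makes the union of the fibres precompact.\<close>

locale asymptotically_compact_cocycle = cocycle \<phi> Y \<sigma>
  for \<phi> :: "real \<Rightarrow> 'x::metric_space \<Rightarrow> 'y::metric_space \<Rightarrow> 'x"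
    and Y :: "'y set" and \<sigma> :: "real \<Rightarrow> 'y \<Rightarrow> 'y" +
  assumes compact_base: "compact Y"
    and flow_cont: "continuous_on Y (\<sigma> t)"
    and cocycle_cont: "0 \<le> t \<Longrightarrow> continuous_on (UNIV \<times> Y) (\<lambda>(x, y). \<phi> t x y)"
    and compact_trajectories:
      "compact M \<Longrightarrow> \<exists>N. compact N \<and> (\<forall>t\<ge>0. \<forall>x\<in>M. \<forall>y\<in>Y. \<phi> t x y \<in> N)"
    and compact_backward_orbits:
      "\<exists>K. compact K \<and> (\<forall>y\<in>Y. \<forall>c. backward_orbit y c \<longrightarrow> c 0 \<in> K)"
begin

definition attractor :: "'y \<Rightarrow> 'x set"
  where "attractor y = {c 0 |c. backward_orbit y c}"

lemma attractorI: "backward_orbit y c \<Longrightarrow> x = c 0 \<Longrightarrow> x \<in> attractor y"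
  unfolding attractor_def by blast

lemma attractor_absorbing:
  obtains K where "compact K" "\<And>y c. y \<in> Y \<Longrightarrow> backward_orbit y c \<Longrightarrow> c 0 \<in> K"
  using compact_backward_orbits by blast

text \<open>The new samples are those of the same complete trajectory, taken \<open>t\<close> later.
  That they form an orbit is the cocycle law for \<open>1 + t\<close>, split in both orders.\<close>

lemma backward_orbit_image:
  assumes y: "y \<in> Y" and t: "0 \<le> t" and c: "backward_orbit y c"
  shows "backward_orbit (\<sigma> t y) (\<lambda>m. \<phi> t (c m) (\<sigma> (- real m) y))"
  unfolding backward_orbit_def
proof (intro conjI allI)
  obtain N where "compact N" "range c \<subseteq> N"
    using c unfolding backward_orbit_def by blast
  moreover obtain N' where "compact N'" "\<And>x y. x \<in> N \<Longrightarrow> y \<in> Y \<Longrightarrow> \<phi> t x y \<in> N'"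
    using compact_trajectories[OF \<open>compact N\<close>] t by blast
  ultimately show "\<exists>N. compact N \<and> range (\<lambda>m. \<phi> t (c m) (\<sigma> (- real m) y)) \<subseteq> N"
    using flow_in[OF y] by (intro exI[of _ N']) auto
next
  fix m
  let ?y = "\<sigma> (- real (Suc m)) y"
  have "\<phi> 1 (\<phi> t (c (Suc m)) ?y) (\<sigma> (- real (Suc m)) (\<sigma> t y)) = \<phi> (1 + t) (c (Suc m)) ?y"
    using t y by (simp add: cocycle_add flow_in flow_add add.commute)
  also have "\<dots> = \<phi> t (\<phi> 1 (c (Suc m)) ?y) (\<sigma> 1 ?y)"
    using cocycle_add[of ?y t 1] flow_in[OF y] t by (simp add: add.commute)
  also have "\<dots> = \<phi> t (c m) (\<sigma> (- real m) y)"
    using c y by (simp add: backward_orbit_def flow_add)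
  finally show "\<phi> 1 (\<phi> t (c (Suc m)) (\<sigma> (- real (Suc m)) y)) (\<sigma> (- real (Suc m)) (\<sigma> t y)) =
      \<phi> t (c m) (\<sigma> (- real m) y)" .
qed

lemma attractor_invariant:
  assumes y: "y \<in> Y" and t: "0 \<le> t"
  shows "(\<lambda>x. \<phi> t x y) ` attractor y = attractor (\<sigma> t y)"
proof
  show "(\<lambda>x. \<phi> t x y) ` attractor y \<subseteq> attractor (\<sigma> t y)"
  proof clarify
    fix x
    assume "x \<in> attractor y"
    then obtain c where c: "x = c 0" "backward_orbit y c"
      unfolding attractor_def by blast
    have "\<phi> t x y = (\<lambda>m. \<phi> t (c m) (\<sigma> (- real m) y)) 0"
      using y c by (simp add: flow_zero)
    then show "\<phi> t x y \<in> attractor (\<sigma> t y)"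
      by (rule attractorI[OF backward_orbit_image[OF y t c(2)]])
  qed
  show "attractor (\<sigma> t y) \<subseteq> (\<lambda>x. \<phi> t x y) ` attractor y"
  proof
    fix x
    assume "x \<in> attractor (\<sigma> t y)"
    then obtain c where c: "x = c 0" "backward_orbit (\<sigma> t y) c"
      unfolding attractor_def by blast
    \<comment> \<open>Only integer times are sampled: from \<open>\<sigma> t y\<close> go back
      \<open>n\<close> whole steps, past time \<open>- t\<close>, and then forward by
      \<open>n - t\<close> to a state over \<open>y\<close>.\<close>
    obtain n :: nat where n: "t \<le> real n"
      using real_arch_simple by blast
    let ?z = "\<sigma> (- real n) (\<sigma> t y)" and ?c = "\<lambda>m. c (m + n)"
    have st: "\<sigma> t y \<in> Y"
      using y by (rule flow_in)
    have z: "?z \<in> Y"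
      using st by (rule flow_in)
    have zy: "\<sigma> (real n - t) ?z = y"
      using y by (simp add: flow_add flow_zero)
    let ?x = "\<phi> (real n - t) (c n) ?z"
    have orb: "backward_orbit y (\<lambda>m. \<phi> (real n - t) (?c m) (\<sigma> (- real m) ?z))"
      using backward_orbit_image[OF z _ backward_orbit_tail[OF st c(2), of n], of "real n - t"] n
      unfolding zy by simp
    have "?x = (\<lambda>m. \<phi> (real n - t) (?c m) (\<sigma> (- real m) ?z)) 0"
      using z by (simp add: flow_zero)
    then have "?x \<in> attractor y"
      by (rule attractorI[OF orb])
    moreover have "\<phi> t ?x y = \<phi> (t + (real n - t)) (c n) ?z"
      using cocycle_add[OF z t, of "real n - t"] n unfolding zy by simp
    then have "\<phi> t ?x y = x"
      using backward_orbit_apply[OF st c(2), of n] c(1) by simp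
    ultimately show "x \<in> (\<lambda>x. \<phi> t x y) ` attractor y"
      by (metis imageI)
  qed
qed

text \<open>All samples of an orbit lie in \<open>K\<close>, and the orbit equation is a closed
  condition because \<open>\<phi> 1\<close> is continuous. The fibre is therefore the projection to
  coordinate 0 of a closed subset of the compact product of copies of \<open>K\<close>.\<close>

lemma compact_attractor:
  assumes y: "y \<in> Y"
  shows "compact (attractor y)"
proof -
  obtain K where K: "compact K" "\<And>y c. y \<in> Y \<Longrightarrow> backward_orbit y c \<Longrightarrow> c 0 \<in> K"
    by (rule attractor_absorbing) blast
  define S where "S = {c. \<forall>m. \<phi> 1 (c (Suc m)) (\<sigma> (- real (Suc m)) y) = c m}"
  have "continuous_on UNIV (\<lambda>c. \<phi> 1 (c (Suc m)) (\<sigma> (- real (Suc m)) y))" for m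
  proof -
    have cont: "continuous_on UNIV (\<lambda>c::nat \<Rightarrow> 'x. (c (Suc m), \<sigma> (- real (Suc m)) y))"
      by (intro continuous_on_Pair continuous_on_const continuous_on_product_coordinates)
    have ran: "range (\<lambda>c::nat \<Rightarrow> 'x. (c (Suc m), \<sigma> (- real (Suc m)) y)) \<subseteq> UNIV \<times> Y"
      using flow_in[OF y] by auto
    show ?thesis
      using continuous_on_compose2[OF cocycle_cont[of 1] cont ran] by simp
  qed
  then have "closed S"
    unfolding S_def by (intro closed_Collect_all closed_Collect_eq continuous_on_product_coordinates)
  then have "compact (S \<inter> {c. \<forall>m. c m \<in> K})"
    using compact_sequence_space[OF K(1)] by (rule closed_Int_compact)
  then have "compact ((\<lambda>c. c 0) ` (S \<inter> {c. \<forall>m. c m \<in> K}))"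
    by (rule compact_continuous_image[rotated])
      (rule continuous_on_subset[OF continuous_on_product_coordinates], simp)
  moreover have "attractor y = (\<lambda>c. c 0) ` (S \<inter> {c. \<forall>m. c m \<in> K})"
  proof -
    have "c \<in> S \<inter> {c. \<forall>m. c m \<in> K}" if c: "backward_orbit y c" for c
    proof -
      have "c m \<in> K" for m
        using K(2)[OF _ backward_orbit_tail[OF y c, of m]] flow_in[OF y] by simp
      then show ?thesis
        using c by (simp add: S_def backward_orbit_def)
    qed
    moreover have "backward_orbit y c" if "c \<in> S \<inter> {c. \<forall>m. c m \<in> K}" for c
      using that K(1) unfolding S_def backward_orbit_def by auto
    ultimately show ?thesis
      unfolding attractor_def by blast
  qed
  ultimately show ?thesis
    by simp
qed

lemma precompact_attractor: "precompact (\<Union>y\<in>Y. attractor y)"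
proof -
  obtain K where K: "compact K" "\<And>y c. y \<in> Y \<Longrightarrow> backward_orbit y c \<Longrightarrow> c 0 \<in> K"
    by (rule attractor_absorbing) blast
  then have "closure (\<Union>y\<in>Y. attractor y) \<subseteq> K"
    by (intro closure_minimal compact_imp_closed) (auto simp: attractor_def)
  then have "closure (\<Union>y\<in>Y. attractor y) = K \<inter> closure (\<Union>y\<in>Y. attractor y)"
    by blast
  then show ?thesis
    unfolding precompact_def using compact_Int_closed[OF K(1) closed_closure] by metis
qed

text \<open>If it fails, there are states at times \<open>t n\<close>, at least \<open>n\<close>,
  that stay \<open>e\<close> away from every fibre. Their pasts, sampled at integer steps, have a
  subsequence converging to a backward orbit, and its present state is a point of the attractor
  closer than \<open>e\<close>.\<close>

lemma attraction:
  assumes M: "compact M" and e: "0 < e"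
  shows "\<exists>T. \<forall>t\<ge>T. \<forall>y\<in>Y. \<forall>x\<in>M. \<exists>b\<in>(\<Union>y\<in>Y. attractor y). dist (\<phi> t x y) b < e"
proof (rule ccontr)
  assume neg: "\<not> ?thesis"
  define P where "P t y x \<longleftrightarrow> y \<in> Y \<and> x \<in> M \<and> (\<forall>b\<in>(\<Union>y\<in>Y. attractor y). \<not> dist (\<phi> t x y) b < e)"
    for t y x
  have "\<forall>n::nat. \<exists>t y x. real n \<le> t \<and> P t y x"
  proof (rule allI, rule ccontr)
    fix n :: nat
    assume none: "\<nexists>t y x. real n \<le> t \<and> P t y x"
    have "\<exists>b\<in>(\<Union>y\<in>Y. attractor y). dist (\<phi> t x y) b < e"
      if "real n \<le> t" "y \<in> Y" "x \<in> M" for t y x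
    proof -
      have "\<not> P t y x"
        using none that(1) by blast
      then show ?thesis
        unfolding P_def using that(2,3) by blast
    qed
    then have "\<forall>t\<ge>real n. \<forall>y\<in>Y. \<forall>x\<in>M. \<exists>b\<in>(\<Union>y\<in>Y. attractor y). dist (\<phi> t x y) b < e"
      by simp
    then show False
      using neg by (elim notE) (rule exI)
  qed
  then obtain t y x where t: "\<And>n::nat. real n \<le> t n" and P: "\<And>n. P (t n) (y n) (x n)"
    by metis
  have y: "y n \<in> Y" and x: "x n \<in> M" for n
    using P[of n] by (simp_all add: P_def)
  have far: "e \<le> dist (\<phi> (t n) (x n) (y n)) b" if "b \<in> (\<Union>y\<in>Y. attractor y)" for n b
    using P[of n] that unfolding P_def not_less by blast
  obtain N where N: "compact N" "\<And>t x y. 0 \<le> t \<Longrightarrow> x \<in> M \<Longrightarrow> y \<in> Y \<Longrightarrow> \<phi> t x y \<in> N"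
    using compact_trajectories[OF M] by blast
  define z where "z n = \<sigma> (t n) (y n)" for n
  \<comment> \<open>Sample \<open>m\<close> steps before time \<open>t n\<close>. Times before the
    start are replaced by 0, which keeps every sample in \<open>N\<close>; for fixed
    \<open>m\<close> this affects only finitely many \<open>n\<close>.\<close>
  define a where "a n m = \<phi> (max 0 (t n - real m)) (x n) (y n)" for n m
  have "seq_compact (Y \<times> {c :: nat \<Rightarrow> 'x. \<forall>m. c m \<in> N})"
    by (intro compact_imp_seq_compact compact_Times compact_base compact_sequence_space N)
  moreover have "\<forall>n. (z n, a n) \<in> Y \<times> {c. \<forall>m. c m \<in> N}"
    using x y N by (auto simp: z_def a_def flow_in)
  ultimately obtain p r where p: "p \<in> Y \<times> {c :: nat \<Rightarrow> 'x. \<forall>m. c m \<in> N}" and r: "strict_mono (r :: nat \<Rightarrow> nat)"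
    and lim: "((\<lambda>n. (z n, a n)) \<circ> r) \<longlonglongrightarrow> p"
    by (rule seq_compactE)
  obtain w c where wc: "p = (w, c)"
    by (cases p)
  have w: "w \<in> Y" and c: "\<And>m. c m \<in> N"
    using p wc by auto
  have zlim: "(\<lambda>n. z (r n)) \<longlonglongrightarrow> w"
    using tendsto_fst[OF lim] wc by (simp add: o_def)
  have alim: "(\<lambda>n. a (r n) m) \<longlonglongrightarrow> c m" for m
  proof -
    have "isCont (\<lambda>c::nat \<Rightarrow> 'x. c m) c"
      by (rule continuous_on_interior[OF continuous_on_product_coordinates]) simp
    moreover have "(\<lambda>n. a (r n)) \<longlonglongrightarrow> c"
      using tendsto_snd[OF lim] wc by (simp add: o_def)
    ultimately show ?thesis
      by (rule isCont_tendsto_compose)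
  qed
  have "\<phi> 1 (c (Suc m)) (\<sigma> (- real (Suc m)) w) = c m" for m
  proof (rule LIMSEQ_unique)
    have "(\<lambda>n. \<sigma> (- real (Suc m)) (z (r n))) \<longlonglongrightarrow> \<sigma> (- real (Suc m)) w"
      by (rule continuous_on_tendsto_compose[OF flow_cont zlim w]) (simp add: z_def y flow_in)
    from tendsto_Pair[OF alim[of "Suc m"] this]
    have "(\<lambda>n. (\<lambda>(x, y). \<phi> 1 x y) (a (r n) (Suc m), \<sigma> (- real (Suc m)) (z (r n))))
        \<longlonglongrightarrow> (\<lambda>(x, y). \<phi> 1 x y) (c (Suc m), \<sigma> (- real (Suc m)) w)"
      by (intro continuous_on_tendsto_compose[OF cocycle_cont[of 1]])
        (use w in \<open>auto simp: z_def y flow_in\<close>)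
    then show "(\<lambda>n. \<phi> 1 (a (r n) (Suc m)) (\<sigma> (- real (Suc m)) (z (r n))))
        \<longlonglongrightarrow> \<phi> 1 (c (Suc m)) (\<sigma> (- real (Suc m)) w)"
      by simp
    \<comment> \<open>The approximating samples satisfy the orbit equation exactly once the
      trajectory is older than \<open>Suc m\<close>; continuity carries it to the limit.\<close>
    have "\<phi> 1 (a n (Suc m)) (\<sigma> (- real (Suc m)) (z n)) = a n m" if "Suc m \<le> n" for n
    proof -
      have "real (Suc m) \<le> t n"
        using t[of n] that by linarith
      moreover from this have "\<phi> (1 + (t n - real (Suc m))) (x n) (y n) =
          \<phi> 1 (\<phi> (t n - real (Suc m)) (x n) (y n)) (\<sigma> (t n - real (Suc m)) (y n))"
        by (intro cocycle_add y) auto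
      ultimately show ?thesis
        unfolding a_def z_def flow_add[OF y] by (simp add: algebra_simps)
    qed
    then have "\<forall>\<^sub>F n in sequentially. a (r n) m = \<phi> 1 (a (r n) (Suc m)) (\<sigma> (- real (Suc m)) (z (r n)))"
      using seq_suble[OF r] by (intro eventually_sequentiallyI[of "Suc m"]) (metis order_trans)
    then show "(\<lambda>n. \<phi> 1 (a (r n) (Suc m)) (\<sigma> (- real (Suc m)) (z (r n)))) \<longlonglongrightarrow> c m"
      by (rule Lim_transform_eventually[OF alim])
  qed
  then have "backward_orbit w c"
    using N(1) c by (auto simp: backward_orbit_def)
  then have c0: "c 0 \<in> (\<Union>y\<in>Y. attractor y)"
    using w by (auto simp: attractor_def)
  have "\<forall>\<^sub>F n in sequentially. dist (a (r n) 0) (c 0) < e"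
    using tendstoD[OF alim e] .
  then obtain n where "dist (a (r n) 0) (c 0) < e"
    by (auto simp: eventually_sequentially)
  moreover have "a (r n) 0 = \<phi> (t (r n)) (x (r n)) (y (r n))"
    using t[of "r n"] by (simp add: a_def max_def)
  ultimately show False
    using far[OF c0, of "r n"] by simp
qed

theorem compact_global_attractor: "compact_global_attractor \<phi> Y \<sigma> attractor"
proof -
  let ?I = "\<Union>y\<in>Y. attractor y"
  have "((\<lambda>t. SUP y\<in>Y. semidist ((\<lambda>x. \<phi> t x y) ` M) ?I) \<longlongrightarrow> 0) at_top" if M: "compact M" for M
  proof (rule order_tendstoI)
    fix a :: ennreal
    assume "a > 0"
    then obtain e where e: "0 < e" "ennreal e < a"
    proof (cases a)
      case (real r)
      then show ?thesis
        using \<open>a > 0\<close> that[of "r / 2"] by (simp add: ennreal_less_iff)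
    next
      case top
      then show ?thesis
        using that[of 1] by simp
    qed
    obtain T where T: "\<And>t y x. T \<le> t \<Longrightarrow> y \<in> Y \<Longrightarrow> x \<in> M \<Longrightarrow> \<exists>b\<in>?I. dist (\<phi> t x y) b < e"
      using attraction[OF M e(1)] by blast
    have "(SUP y\<in>Y. semidist ((\<lambda>x. \<phi> t x y) ` M) ?I) \<le> ennreal e" if t: "T \<le> t" for t
      unfolding semidist_def
    proof (intro SUP_least, clarify)
      fix y x
      assume "y \<in> Y" "x \<in> M"
      from T[OF t this] obtain b where "b \<in> ?I" "dist (\<phi> t x y) b < e"
        by blast
      then show "(INF b\<in>?I. ennreal (dist (\<phi> t x y) b)) \<le> ennreal e"
        by (intro INF_lower2) (auto intro: ennreal_leI)
    qed
    then show "\<forall>\<^sub>F t in at_top. (SUP y\<in>Y. semidist ((\<lambda>x. \<phi> t x y) ` M) ?I) < a"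
      using e(2) by (intro eventually_at_top_linorderI[of T]) (rule le_less_trans)
  qed simp
  then show ?thesis
    by (simp add: compact_global_attractor_def compact_attractor precompact_attractor attractor_invariant)
qed

end

section \<open>Differential inequalities and initial value problems\<close>

text \<open>With the integrating factor, \<open>exp (- a * t) * (p t + b / a)\<close> does not
  increase. The sign of \<open>a\<close> is left open: it is negative for the decay of energies and
  positive for the separation of two solutions.\<close>

lemma gronwall:
  fixes p p' :: "real \<Rightarrow> real"
  assumes deriv: "\<And>t. 0 \<le> t \<Longrightarrow> t \<le> T \<Longrightarrow> (p has_real_derivative p' t) (at t within {0..})"
    and bound: "\<And>t. 0 \<le> t \<Longrightarrow> t \<le> T \<Longrightarrow> p' t \<le> a * p t + b"
    and "a \<noteq> 0" "0 \<le> T"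
  shows "p T \<le> exp (a * T) * (p 0 + b / a) - b / a"
proof -
  define q where "q t = exp (- a * t) * (p t + b / a)" for t
  have dq: "(q has_real_derivative exp (- a * t) * (p' t - a * p t - b)) (at t within {0..})"
    if "0 \<le> t" "t \<le> T" for t
    unfolding q_def using deriv[OF that] \<open>a \<noteq> 0\<close>
    by (auto intro!: derivative_eq_intros simp: field_simps)
  have "q T \<le> q 0"
  proof (rule DERIV_nonpos_imp_decreasing_open[OF \<open>0 \<le> T\<close>])
    fix t
    assume t: "0 < t" "t < T"
    then have "at t within {0..} = at t"
      by (intro at_within_interior) (simp add: interior_real_atLeast)
    with t dq[of t] have "(q has_real_derivative exp (- a * t) * (p' t - a * p t - b)) (at t)"
      by simp
    moreover have "exp (- a * t) * (p' t - a * p t - b) \<le> 0"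
      using bound[of t] t by (intro mult_nonneg_nonpos) auto
    ultimately show "\<exists>y. (q has_real_derivative y) (at t) \<and> y \<le> 0"
      by blast
  next
    show "continuous_on {0..T} q"
      unfolding continuous_on_eq_continuous_within
    proof
      fix t
      assume "t \<in> {0..T}"
      then have "continuous (at t within {0..}) q"
        using dq[of t] by (auto intro: DERIV_continuous)
      then show "continuous (at t within {0..T}) q"
        by (rule continuous_within_subset) auto
    qed
  qed
  then have "exp (a * T) * (exp (- a * T) * (p T + b / a)) \<le> exp (a * T) * (p 0 + b / a)"
    by (intro mult_left_mono) (simp_all add: q_def)
  then show ?thesis
    by (simp add: mult.assoc[symmetric] exp_minus)
qed

lemma has_vector_derivative_integral_atLeast:
  fixes h :: "real \<Rightarrow> 'a::banach"
  assumes "continuous_on {0..} h" "0 \<le> t"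
  shows "((\<lambda>t. integral {0..t} h) has_vector_derivative h t) (at t within {0..})"
proof -
  \<comment> \<open>The right end lies beyond \<open>t\<close>, so near \<open>t\<close> the
    interval and the half-line agree.\<close>
  have "((\<lambda>t. integral {0..t} h) has_vector_derivative h t) (at t within {0..t + 1})"
    by (rule integral_has_vector_derivative) (use assms in \<open>auto intro: continuous_on_subset\<close>)
  moreover have "at t within {0..t + 1} = at t within {0..}"
    by (rule at_within_nhd[of t "{..<t + 1}"]) auto
  ultimately show ?thesis
    by simp
qed

text \<open>Integration reproduces the weight \<open>exp (M * s)\<close> at the price of a factor
  \<open>1 / M\<close>; this is where the contraction constant \<open>L / M\<close> of the Picard
  operator comes from.\<close>

lemma norm_integral_le_exp:
  fixes h :: "real \<Rightarrow> 'a::banach"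
  assumes "continuous_on {0..} h" "0 < M" "0 \<le> t" "0 \<le> D"
    and bound: "\<And>s. 0 \<le> s \<Longrightarrow> norm (h s) \<le> D * exp (M * s)"
  shows "norm (integral {0..t} h) \<le> D / M * exp (M * t)"
proof -
  have "((\<lambda>s. D * exp (M * s)) has_integral D / M * exp (M * t) - D / M * exp (M * 0)) {0..t}"
    by (rule fundamental_theorem_of_calculus)
      (use assms in \<open>auto intro!: derivative_eq_intros simp: has_real_derivative_iff_has_vector_derivative[symmetric]\<close>)
  from integral_unique[OF this]
  have "integral {0..t} (\<lambda>s. D * exp (M * s)) = D / M * exp (M * t) - D / M"
    by simp
  moreover have "norm (integral {0..t} h) \<le> integral {0..t} (\<lambda>s. D * exp (M * s))"
    by (intro integral_norm_bound_integral integrable_continuous_real)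
      (use assms in \<open>auto intro: continuous_on_subset intro!: continuous_intros\<close>)
  moreover have "0 \<le> D / M"
    using assms by simp
  ultimately show ?thesis
    by linarith
qed

text \<open>The Picard operator is a contraction for the norm \<open>sup exp (- (L + 1) t) * norm (u t)\<close>, so no
  gluing of local solutions is needed.\<close>

theorem lipschitz_initial_value_problem:
  fixes G :: "'a::banach \<Rightarrow> 'a" and g :: "real \<Rightarrow> 'a"
  assumes lip: "L-lipschitz_on UNIV G" and cont: "continuous_on UNIV g" and bound: "\<And>t. norm (g t) \<le> C"
  shows "\<exists>u. u 0 = v \<and> (\<forall>t\<ge>0. (u has_vector_derivative G (u t) + g t) (at t within {0..}))"
proof -
  define M where "M = L + 1"
  have L: "0 \<le> L"
    using lip by (rule lipschitz_on_nonneg)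
  then have M: "0 < M"
    by (simp add: M_def)
  have G: "norm (G x - G y) \<le> L * norm (x - y)" for x y
    using lipschitz_onD[OF lip, of x y] by (simp add: dist_norm)
  have Gcont: "continuous_on UNIV G"
    using lip by (rule lipschitz_on_continuous_on)
  \<comment> \<open>The unknown is the rescaled curve \<open>w\<close>, with solution
    \<open>exp (M * t) *\<^sub>R w t\<close>: the weighted norm of the solution is then the supremum
    norm of \<open>w\<close>.\<close>
  define h where "h w s = G (exp (M * s) *\<^sub>R apply_bcontfun w s) + g s" for w s
  \<comment> \<open>Bounded continuous functions live on the whole line, so the image is extended to
    negative times by its value at 0.\<close>
  define P where "P w t = exp (- M * max 0 t) *\<^sub>R (v + integral {0..max 0 t} (h w))" for w t
  have hcont: "continuous_on S (h w)" for S w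
    unfolding h_def
    by (intro continuous_intros continuous_on_compose2[OF Gcont] continuous_on_subset[OF cont]) auto
  have hbound: "norm (h w s) \<le> (norm (G 0) + L * norm w + C) * exp (M * s)" if "0 \<le> s" for w s
  proof -
    have "norm (h w s) \<le> norm (G 0) + norm (G (exp (M * s) *\<^sub>R apply_bcontfun w s) - G 0) + norm (g s)"
      unfolding h_def by norm
    also have "\<dots> \<le> norm (G 0) + L * (exp (M * s) * norm (apply_bcontfun w s)) + C"
      using G[of "exp (M * s) *\<^sub>R apply_bcontfun w s" 0] bound[of s] by simp
    also have "\<dots> \<le> norm (G 0) * exp (M * s) + L * (exp (M * s) * norm w) + C * exp (M * s)"
    proof -
      have "1 \<le> exp (M * s)"
        using M that by simp
      moreover have "0 \<le> C"
        using bound[of 0] norm_ge_zero order_trans by blast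
      ultimately have "norm (G 0) \<le> norm (G 0) * exp (M * s)" "C \<le> C * exp (M * s)"
        by (simp_all add: mult_le_cancel_left1)
      moreover have "L * (exp (M * s) * norm (apply_bcontfun w s)) \<le> L * (exp (M * s) * norm w)"
        using L by (intro mult_left_mono norm_bounded) auto
      ultimately show ?thesis
        by linarith
    qed
    finally show ?thesis
      by (simp add: algebra_simps)
  qed
  have P_bcontfun: "P w \<in> bcontfun" for w
  proof -
    define D where "D = norm (G 0) + L * norm w + C"
    have D: "0 \<le> D"
      using order_trans[OF norm_ge_zero hbound[of 0 w]] unfolding D_def by simp
    have "continuous_on {0..} (\<lambda>t. integral {0..t} (h w))"
      unfolding continuous_on_eq_continuous_within
      using has_vector_derivative_integral_atLeast[OF hcont]
      by (auto intro: has_vector_derivative_continuous)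
    then have "continuous_on UNIV (\<lambda>t. integral {0..max 0 t} (h w))"
      by (rule continuous_on_compose2) (auto intro!: continuous_intros)
    then have "continuous_on UNIV (P w)"
      unfolding P_def by (intro continuous_intros)
    moreover have "norm (P w t) \<le> norm v + D / M" for t
    proof -
      let ?t = "max 0 t"
      have "norm (integral {0..?t} (h w)) \<le> D / M * exp (M * ?t)"
        by (rule norm_integral_le_exp) (use M D hcont hbound in \<open>auto simp: D_def\<close>)
      then have "norm (v + integral {0..?t} (h w)) \<le> norm v + D / M * exp (M * ?t)"
        by (rule order_trans[OF norm_triangle_ineq add_left_mono])
      also have "\<dots> \<le> norm v * exp (M * ?t) + D / M * exp (M * ?t)"
        using M by (simp add: mult_le_cancel_left1)
      finally have "exp (- M * ?t) * norm (v + integral {0..?t} (h w))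
          \<le> exp (- M * ?t) * ((norm v + D / M) * exp (M * ?t))"
        by (intro mult_left_mono) (simp_all add: distrib_right)
      also have "\<dots> = norm v + D / M"
        by (simp add: exp_minus)
      finally show ?thesis
        by (simp add: P_def)
    qed
    ultimately show ?thesis
      unfolding bcontfun_def by (auto intro: boundedI)
  qed
  define Q where "Q w = Bcontfun (P w)" for w
  have Q: "apply_bcontfun (Q w) = P w" for w
    unfolding Q_def by (rule Bcontfun_inverse[OF P_bcontfun])
  have contraction: "dist (Q w) (Q z) \<le> (L / M) * dist w z" for w z
  proof (rule dist_bound)
    fix t :: real
    let ?t = "max 0 t" and ?D = "L * dist w z"
    have "norm (h w s - h z s) \<le> ?D * exp (M * s)" for s
    proof -
      have "norm (h w s - h z s) \<le> L * norm (exp (M * s) *\<^sub>R apply_bcontfun w s - exp (M * s) *\<^sub>R apply_bcontfun z s)"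
        using G by (simp add: h_def)
      also have "\<dots> = L * (exp (M * s) * dist (apply_bcontfun w s) (apply_bcontfun z s))"
        by (simp add: dist_norm scaleR_diff_right[symmetric])
      also have "\<dots> \<le> L * (exp (M * s) * dist w z)"
        using L by (intro mult_left_mono dist_bounded) auto
      finally show ?thesis
        by (simp add: ac_simps)
    qed
    then have "norm (integral {0..?t} (\<lambda>s. h w s - h z s)) \<le> ?D / M * exp (M * ?t)"
      by (intro norm_integral_le_exp continuous_intros hcont M) (use L in auto)
    moreover have "integral {0..?t} (\<lambda>s. h w s - h z s) = integral {0..?t} (h w) - integral {0..?t} (h z)"
      by (intro Henstock_Kurzweil_Integration.integral_diff integrable_continuous_real hcont)
    ultimately have "exp (- M * ?t) * norm (integral {0..?t} (h w) - integral {0..?t} (h z))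
        \<le> exp (- M * ?t) * (?D / M * exp (M * ?t))"
      by (intro mult_left_mono) auto
    also have "\<dots> = L / M * dist w z"
      by (simp add: exp_minus)
    finally show "dist (apply_bcontfun (Q w) t) (apply_bcontfun (Q z) t) \<le> L / M * dist w z"
      by (simp add: Q P_def dist_norm scaleR_diff_right[symmetric])
  qed
  have "\<exists>!w. Q w = w"
    by (rule banach_fix_type[of "L / M"]) (use contraction L M in \<open>auto simp: M_def\<close>)
  then obtain w where w: "Q w = w"
    by blast
  define u where "u t = v + integral {0..t} (h w)" for t
  have uw: "exp (M * t) *\<^sub>R apply_bcontfun w t = u t" if "0 \<le> t" for t
  proof -
    have "apply_bcontfun w t = exp (- M * t) *\<^sub>R u t"
      using Q[of w] that by (simp add: w P_def u_def)
    then show ?thesis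
      by (simp add: exp_minus)
  qed
  have "(u has_vector_derivative G (u t) + g t) (at t within {0..})" if "0 \<le> t" for t
  proof -
    have "(u has_vector_derivative 0 + h w t) (at t within {0..})"
      unfolding u_def
      by (intro derivative_intros has_vector_derivative_integral_atLeast hcont that)
    then show ?thesis
      using uw[OF that] by (simp add: h_def)
  qed
  moreover have "u 0 = v"
    by (simp add: u_def)
  ultimately show ?thesis
    by blast
qed

section \<open>Weighted energies and compactness in the sequence space\<close>

instance ell2 :: banach ..

lemma ell2_eqI: "(\<And>i. coord u i = coord v i) \<Longrightarrow> u = v"
  by (simp add: coord_inject[symmetric] fun_eq_iff)

lemma coord_plus [simp]: "coord (u + v) i = coord u i + coord v i"
  by (simp add: plus_ell2.rep_eq)

lemma coord_scaleR [simp]: "coord (c *\<^sub>R u) i = c * coord u i"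
  by (simp add: scaleR_ell2.rep_eq)

lemma coord_zero [simp]: "coord 0 i = 0"
  by (simp add: zero_ell2.rep_eq)

lemma coord_sum [simp]: "coord (sum f A) i = (\<Sum>x\<in>A. coord (f x) i)"
  by (induction A rule: infinite_finite_induct) auto

lemma coord_laplacian [simp]: "coord (laplacian u) i = coord u (i - 1) - 2 * coord u i + coord u (i + 1)"
  by (simp add: laplacian.rep_eq)

lemma coord_mult_summable: "(\<lambda>i. coord u i * coord v i) summable_on UNIV"
  by (rule sq_summable_mult[OF coord_sq_summable coord_sq_summable])

lemma inner_mono_coord:
  assumes "\<And>i. coord u i * coord v i \<le> coord x i * coord y i"
  shows "inner u v \<le> inner x y"
  unfolding inner_ell2.rep_eq by (intro infsum_mono coord_mult_summable assms)

lemma norm_le_norm_coord: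
  assumes "\<And>i. \<bar>coord u i\<bar> \<le> L * \<bar>coord v i\<bar>" "0 \<le> L"
  shows "norm u \<le> L * norm v"
proof -
  have "coord u i * coord u i \<le> coord (L *\<^sub>R v) i * coord (L *\<^sub>R v) i" for i
    using assms abs_le_square_iff[of "coord u i" "L * coord v i"]
    by (simp add: abs_mult power2_eq_square)
  then have "inner u u \<le> inner (L *\<^sub>R v) (L *\<^sub>R v)"
    by (rule inner_mono_coord)
  then have "norm u \<le> norm (L *\<^sub>R v)"
    by (simp add: norm_eq_sqrt_inner)
  then show ?thesis
    using assms(2) by simp
qed

lemma bij_plus_int: "bij (\<lambda>i::int. i + k)"
  by (rule bij_betwI[where g = "\<lambda>i. i - k"]) auto

lemma infsum_shift_int: "(\<Sum>\<^sub>\<infinity>i::int. f (i + k)) = infsum f UNIV"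
  by (rule infsum_reindex_bij_betw[OF bij_plus_int])

lemma summable_on_shift_int: "(\<lambda>i::int. f (i + k)) summable_on UNIV \<longleftrightarrow> f summable_on UNIV"
  by (rule summable_on_reindex_bij_betw[OF bij_plus_int])

lemma laplacian_diff: "laplacian (u - v) = laplacian u - laplacian v"
  by (rule ell2_eqI) simp

lemma norm_laplacian_le: "norm (laplacian u) \<le> 4 * norm u"
proof -
  let ?c = "\<lambda>i. (coord u i)\<^sup>2"
  have s: "(\<lambda>i. ?c (i + k)) summable_on UNIV" for k
    by (simp add: summable_on_shift_int[of ?c] coord_sq_summable)
  \<comment> \<open>Cauchy-Schwarz with weights 1, 2, 1; the coefficients add up to 16, the square
    of the constant 4.\<close>
  have "(a - 2 * b + c)\<^sup>2 \<le> 4 * a\<^sup>2 + 8 * b\<^sup>2 + 4 * c\<^sup>2" for a b c :: real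
  proof -
    have "0 \<le> 2 * (a + b)\<^sup>2 + (a - c)\<^sup>2 + 2 * (b + c)\<^sup>2"
      by simp
    then show ?thesis
      by (simp add: power2_eq_square algebra_simps)
  qed
  then have "(norm (laplacian u))\<^sup>2 \<le> (\<Sum>\<^sub>\<infinity>i. 4 * ?c (i + - 1) + 8 * ?c i + 4 * ?c (i + 1))"
    unfolding norm_ell2_sq
    by (intro infsum_mono coord_sq_summable summable_on_add summable_on_cmult_right s) auto
  also have "\<dots> = 4 * (\<Sum>\<^sub>\<infinity>i. ?c (i + - 1)) + 8 * (\<Sum>\<^sub>\<infinity>i. ?c i) + 4 * (\<Sum>\<^sub>\<infinity>i. ?c (i + 1))"
    by (simp only: infsum_add summable_on_add summable_on_cmult_right s coord_sq_summable infsum_cmult_right')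
  also have "\<dots> = (4 * norm u)\<^sup>2"
    unfolding infsum_shift_int[of ?c] by (simp add: norm_ell2_sq power_mult_distrib)
  finally show ?thesis
    by (rule power2_le_imp_le) simp
qed

section \<open>Weights with values in [0, 1] and their energies\<close>

definition unit_weight :: "(int \<Rightarrow> real) \<Rightarrow> bool"
  where "unit_weight \<theta> \<longleftrightarrow> (\<forall>i. 0 \<le> \<theta> i \<and> \<theta> i \<le> 1)"

definition weighted :: "(int \<Rightarrow> real) \<Rightarrow> ell2 \<Rightarrow> ell2"
  where "weighted \<theta> u = Abs_ell2 (\<lambda>i. \<theta> i * coord u i)"

lemma coord_weighted:
  assumes "unit_weight \<theta>"
  shows "coord (weighted \<theta> u) i = \<theta> i * coord u i"
proof -
  have "(\<theta> i * coord u i)\<^sup>2 \<le> (coord u i)\<^sup>2" for i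
  proof -
    have "\<bar>\<theta> i\<bar> \<le> 1"
      using assms by (simp add: unit_weight_def)
    then have "\<bar>\<theta> i * coord u i\<bar> \<le> \<bar>coord u i\<bar>"
      unfolding abs_mult by (rule mult_left_le_one_le[rotated 2]) auto
    then show ?thesis
      by (simp add: abs_le_square_iff)
  qed
  then have "(\<lambda>i. (\<theta> i * coord u i)\<^sup>2) summable_on UNIV"
    by (intro summable_on_comparison_test[OF coord_sq_summable]) auto
  then show ?thesis
    by (simp add: weighted_def Abs_ell2_inverse)
qed

lemma weighted_one [simp]: "weighted (\<lambda>_. 1) u = u"
  by (rule ell2_eqI) (simp add: coord_weighted unit_weight_def)

lemma bounded_linear_weighted:
  assumes "unit_weight \<theta>"
  shows "bounded_linear (weighted \<theta>)"
proof (rule bounded_linear_intro[where K = 1])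
  show "weighted \<theta> (u + v) = weighted \<theta> u + weighted \<theta> v" for u v
    by (rule ell2_eqI) (simp add: coord_weighted[OF assms] distrib_left)
  show "weighted \<theta> (r *\<^sub>R u) = r *\<^sub>R weighted \<theta> u" for r u
    by (rule ell2_eqI) (simp add: coord_weighted[OF assms])
  have "norm (weighted \<theta> u) \<le> 1 * norm u" for u
    using assms by (intro norm_le_norm_coord)
      (auto simp: coord_weighted[OF assms] abs_mult unit_weight_def intro: mult_left_le_one_le)
  then show "norm (weighted \<theta> u) \<le> norm u * 1" for u
    by simp
qed

text \<open>Phrased through the inner product and a bounded linear operator, so that it can be
  differentiated along a curve without interchanging a series and a derivative.\<close>

definition energy :: "(int \<Rightarrow> real) \<Rightarrow> ell2 \<Rightarrow> real"
  where "energy \<theta> u = inner u (weighted \<theta> u)"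

lemma energy_one [simp]: "energy (\<lambda>_. 1) u = (norm u)\<^sup>2"
  by (simp add: energy_def power2_norm_eq_inner)

lemma energy_summable:
  assumes "unit_weight \<theta>"
  shows "(\<lambda>i. \<theta> i * (coord u i)\<^sup>2) summable_on UNIV"
  using coord_mult_summable[of u "weighted \<theta> u"]
  by (simp add: coord_weighted[OF assms] power2_eq_square ac_simps)

lemma energy_infsum:
  assumes "unit_weight \<theta>"
  shows "energy \<theta> u = (\<Sum>\<^sub>\<infinity>i. \<theta> i * (coord u i)\<^sup>2)"
  by (simp add: energy_def inner_ell2.rep_eq coord_weighted[OF assms] power2_eq_square ac_simps)

lemma energy_nonneg:
  assumes "unit_weight \<theta>"
  shows "0 \<le> energy \<theta> u"
  unfolding energy_infsum[OF assms] using assms by (intro infsum_nonneg) (simp add: unit_weight_def)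

lemma energy_le_norm:
  assumes "unit_weight \<theta>"
  shows "energy \<theta> u \<le> (norm u)\<^sup>2"
  unfolding energy_infsum[OF assms] norm_ell2_sq using assms
  by (intro infsum_mono energy_summable coord_sq_summable)
    (simp_all add: unit_weight_def mult_left_le_one_le)

lemma inner_weighted_commute:
  assumes "unit_weight \<theta>"
  shows "inner u (weighted \<theta> v) = inner v (weighted \<theta> u)"
  by (simp add: inner_ell2.rep_eq coord_weighted[OF assms] ac_simps)

lemma energy_scaleR_add:
  assumes "unit_weight \<theta>"
  shows "energy \<theta> (u + c *\<^sub>R v) = energy \<theta> u + 2 * c * inner u (weighted \<theta> v) + c\<^sup>2 * energy \<theta> v"
proof -
  interpret bounded_linear "weighted \<theta>"
    by (rule bounded_linear_weighted[OF assms])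
  show ?thesis
    using inner_weighted_commute[OF assms, of v u]
    by (simp add: energy_def add scale inner_simps power2_eq_square algebra_simps)
qed

lemma inner_weighted_young:
  assumes "unit_weight \<theta>" "0 < c"
  shows "2 * inner u (weighted \<theta> v) \<le> energy \<theta> u / c + c * energy \<theta> v"
proof -
  have "0 \<le> energy \<theta> (u + (- c) *\<^sub>R v)"
    by (rule energy_nonneg[OF assms(1)])
  then have "2 * c * inner u (weighted \<theta> v) \<le> energy \<theta> u + c\<^sup>2 * energy \<theta> v"
    unfolding energy_scaleR_add[OF assms(1)] by simp
  then have "c * (2 * inner u (weighted \<theta> v)) \<le> c * (energy \<theta> u / c + c * energy \<theta> v)"
    using assms(2) by (simp add: power2_eq_square algebra_simps)
  then show ?thesis
    using assms(2) by (simp only: mult_le_cancel_left_pos)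
qed

lemma energy_add_le:
  assumes "unit_weight \<theta>"
  shows "energy \<theta> (u + v) \<le> 2 * energy \<theta> u + 2 * energy \<theta> v"
  using energy_scaleR_add[OF assms, of u 1 v] inner_weighted_young[OF assms zero_less_one, of u v] by simp

text \<open>Estimating the products of neighbours by \<open>2 a b \<le> a\<^sup>2 + b\<^sup>2\<close> and shifting the index moves the
  discrete Laplacian to the weight.\<close>

lemma inner_laplacian_weighted_le:
  assumes \<theta>: "unit_weight \<theta>" and concave: "\<And>i. (\<theta> (i - 1) + \<theta> (i + 1)) / 2 - \<theta> i \<le> \<eta>"
  shows "inner (laplacian u) (weighted \<theta> u) \<le> \<eta> * (norm u)\<^sup>2"
proof -
  let ?c = "\<lambda>i. (coord u i)\<^sup>2"
  let ?e = "\<lambda>i. \<theta> i * ?c i"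
  have w: "unit_weight (\<lambda>i. \<theta> (i + k))" for k
    using \<theta> by (simp add: unit_weight_def)
  have e: "?e summable_on UNIV"
    by (rule energy_summable[OF \<theta>])
  have s: "(\<lambda>i. \<theta> i * ?c (i + k)) summable_on UNIV" for k
    using energy_summable[OF w[of "- k"], of u] summable_on_shift_int[of "\<lambda>i. \<theta> (i + - k) * ?c i" k] by simp
  have shift: "(\<Sum>\<^sub>\<infinity>i. \<theta> i * ?c (i + k)) = (\<Sum>\<^sub>\<infinity>i. \<theta> (i + - k) * ?c i)" for k
    using infsum_shift_int[of "\<lambda>i. \<theta> (i + - k) * ?c i" k] by simp
  have point: "(a - 2 * b + c) * (t * b) \<le> t * a\<^sup>2 / 2 + t * c\<^sup>2 / 2 + (- 1) * (t * b\<^sup>2)"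
    if "0 \<le> t" for a b c t :: real
  proof -
    have "0 \<le> t * ((a - b)\<^sup>2 + (c - b)\<^sup>2)"
      using that by simp
    then show ?thesis
      by (simp add: power2_eq_square algebra_simps)
  qed
  have "inner (laplacian u) (weighted \<theta> u)
      \<le> (\<Sum>\<^sub>\<infinity>i. 1/2 * (\<theta> i * ?c (i + - 1)) + 1/2 * (\<theta> i * ?c (i + 1)) + (- 1) * ?e i)"
    unfolding inner_ell2.rep_eq
  proof (intro infsum_mono coord_mult_summable summable_on_add summable_on_cmult_right s e)
    fix i
    show "coord (laplacian u) i * coord (weighted \<theta> u) i
        \<le> 1/2 * (\<theta> i * ?c (i + - 1)) + 1/2 * (\<theta> i * ?c (i + 1)) + (- 1) * ?e i"
      using point[of "\<theta> i" "coord u (i - 1)" "coord u i" "coord u (i + 1)"] \<theta>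
      by (simp add: coord_weighted[OF \<theta>] unit_weight_def)
  qed
  also have "\<dots> = 1/2 * (\<Sum>\<^sub>\<infinity>i. \<theta> (i + - (- 1)) * ?c i) + 1/2 * (\<Sum>\<^sub>\<infinity>i. \<theta> (i + - 1) * ?c i) + (- 1) * (\<Sum>\<^sub>\<infinity>i. ?e i)"
    by (simp only: infsum_add summable_on_add summable_on_cmult_right s e infsum_cmult_right' shift)
  also have "\<dots> = (\<Sum>\<^sub>\<infinity>i. 1/2 * (\<theta> (i + - (- 1)) * ?c i) + 1/2 * (\<theta> (i + - 1) * ?c i) + (- 1) * ?e i)"
    by (simp only: infsum_add summable_on_add summable_on_cmult_right energy_summable[OF w] e infsum_cmult_right')
  also have "\<dots> \<le> (\<Sum>\<^sub>\<infinity>i. \<eta> * ?c i)"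
  proof (intro infsum_mono summable_on_add summable_on_cmult_right energy_summable[OF w] e coord_sq_summable)
    fix i
    have "((\<theta> (i - 1) + \<theta> (i + 1)) / 2 - \<theta> i) * ?c i \<le> \<eta> * ?c i"
      by (rule mult_right_mono[OF concave]) simp
    then show "1/2 * (\<theta> (i + - (- 1)) * ?c i) + 1/2 * (\<theta> (i + - 1) * ?c i) + (- 1) * ?e i \<le> \<eta> * ?c i"
      by (simp add: algebra_simps add_divide_distrib)
  qed
  also have "\<dots> = \<eta> * (norm u)\<^sup>2"
    by (simp add: infsum_cmult_right' norm_ell2_sq)
  finally show ?thesis .
qed

section \<open>Cut-off weights and uniform smallness of tails\<close>

text \<open>For positive \<eta> the weight is 0 up to \<open>1 / \<eta>\<close> in modulus, 1 from
  \<open>2 / \<eta>\<close> on, and linear between. As \<eta> tends to 0, its support recedes to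
  infinity and its slope vanishes at the same time.\<close>

definition cutoff :: "real \<Rightarrow> int \<Rightarrow> real"
  where "cutoff \<eta> i = max 0 (min 1 (\<eta> * \<bar>real_of_int i\<bar> - 1))"

lemma unit_weight_cutoff: "unit_weight (cutoff \<eta>)"
  by (simp add: unit_weight_def cutoff_def)

text \<open>Clamping preserves the Lipschitz constant \<eta>, so each neighbouring value exceeds the
  central one by at most \<eta>, and so does their mean.\<close>

lemma cutoff_laplacian_le:
  assumes "0 \<le> \<eta>"
  shows "(cutoff \<eta> (i - 1) + cutoff \<eta> (i + 1)) / 2 - cutoff \<eta> i \<le> \<eta>"
proof -
  have clamp: "max 0 (min 1 y) \<le> max 0 (min 1 x) + \<eta>" if "y \<le> x + \<eta>" for x y :: real
    using that assms by linarith
  have "cutoff \<eta> j \<le> cutoff \<eta> i + \<eta>" if "\<bar>j - i\<bar> \<le> 1" for j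
  proof -
    have "\<eta> * \<bar>real_of_int j\<bar> \<le> \<eta> * (\<bar>real_of_int i\<bar> + 1)"
      using that by (intro mult_left_mono assms) linarith
    then show ?thesis
      unfolding cutoff_def by (intro clamp) (simp add: distrib_left)
  qed
  from this[of "i - 1"] this[of "i + 1"] show ?thesis
    by (simp add: field_simps)
qed

text \<open>The filter at 0 from the right lets several demands on \<eta>, from the initial states,
  the forcing and the coupling, be met at once.\<close>

definition uniformly_small_tails :: "ell2 set \<Rightarrow> bool"
  where "uniformly_small_tails S \<longleftrightarrow> (\<forall>e>0. \<forall>\<^sub>F \<eta> in at_right 0. \<forall>u\<in>S. energy (cutoff \<eta>) u < e)"

lemma uniformly_small_tailsD:
  "uniformly_small_tails S \<Longrightarrow> 0 < e \<Longrightarrow> \<forall>\<^sub>F \<eta> in at_right 0. \<forall>u\<in>S. energy (cutoff \<eta>) u < e"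
  by (simp add: uniformly_small_tails_def)

text \<open>A finite set of indices carries the squared norm up to \<open>e / 2\<close>, and for
  small \<eta> the weight vanishes on it.\<close>

lemma eventually_energy_cutoff_less:
  assumes "0 < e"
  shows "\<forall>\<^sub>F \<eta> in at_right 0. energy (cutoff \<eta>) u < e"
proof -
  let ?c = "\<lambda>i. (coord u i)\<^sup>2"
  obtain A where A: "finite A" "dist (sum ?c A) (infsum ?c UNIV) \<le> e / 2"
    using infsum_finite_approximation[OF coord_sq_summable, of "e / 2" u] assms by auto
  have "\<forall>\<^sub>F \<eta> in at_right 0. \<eta> * \<bar>real_of_int i\<bar> < 1" for i
  proof -
    have "((\<lambda>\<eta>. \<eta> * \<bar>real_of_int i\<bar>) \<longlongrightarrow> 0 * \<bar>real_of_int i\<bar>) (at_right 0)"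
      by (intro tendsto_intros)
    then show ?thesis
      by (rule order_tendstoD) simp
  qed
  then have "\<forall>\<^sub>F \<eta> in at_right 0. \<forall>i\<in>A. \<eta> * \<bar>real_of_int i\<bar> < 1"
    by (simp add: eventually_ball_finite A)
  then show ?thesis
  proof (rule eventually_mono)
    fix \<eta> :: real
    assume \<eta>: "\<forall>i\<in>A. \<eta> * \<bar>real_of_int i\<bar> < 1"
    have fin: "(\<lambda>i. if i \<in> A then ?c i else 0) summable_on UNIV"
      by (rule summable_on_comparison_test[OF coord_sq_summable[of u]]) auto
    have "energy (cutoff \<eta>) u \<le> (\<Sum>\<^sub>\<infinity>i. ?c i + (- 1) * (if i \<in> A then ?c i else 0))"
      unfolding energy_infsum[OF unit_weight_cutoff]
    proof (intro infsum_mono summable_on_add summable_on_cmult_right energy_summable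
        unit_weight_cutoff coord_sq_summable fin)
      fix i
      show "cutoff \<eta> i * ?c i \<le> ?c i + (- 1) * (if i \<in> A then ?c i else 0)"
        using \<eta> unit_weight_cutoff[of \<eta>] by (auto simp: cutoff_def unit_weight_def mult_left_le_one_le)
    qed
    also have "\<dots> = infsum ?c UNIV - (\<Sum>\<^sub>\<infinity>i. if i \<in> A then ?c i else 0)"
      by (simp only: infsum_add summable_on_cmult_right coord_sq_summable fin infsum_cmult_right')
    also have "(\<Sum>\<^sub>\<infinity>i. if i \<in> A then ?c i else 0) = infsum ?c A"
      by (rule infsum_cong_neutral) auto
    also have "infsum ?c UNIV - infsum ?c A < e"
      using A(2) assms unfolding dist_real_def infsum_finite[OF A(1)] by linarith
    finally show "energy (cutoff \<eta>) u < e" .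
  qed
qed

lemma compact_imp_uniformly_small_tails:
  assumes "compact S"
  shows "uniformly_small_tails S"
  unfolding uniformly_small_tails_def
proof (intro allI impI)
  fix e :: real
  assume e: "0 < e"
  \<comment> \<open>\<open>energy_add_le\<close> doubles both the energy of the net point and that
    of the remainder; a quarter of \<open>e\<close> for each gives \<open>e\<close>, strictly
    because of the net point.\<close>
  define r where "r = sqrt (e / 4)"
  have r: "0 < r" "r\<^sup>2 = e / 4"
    using e by (simp_all add: r_def)
  obtain k where k: "finite k" "S \<subseteq> (\<Union>x\<in>k. ball x r)"
    using assms r(1) unfolding compact_eq_totally_bounded by blast
  have "\<forall>\<^sub>F \<eta> in at_right 0. \<forall>x\<in>k. energy (cutoff \<eta>) x < e / 4"
    using e by (intro eventually_ball_finite k ballI eventually_energy_cutoff_less) simp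
  then show "\<forall>\<^sub>F \<eta> in at_right 0. \<forall>u\<in>S. energy (cutoff \<eta>) u < e"
  proof (rule eventually_mono, intro ballI)
    fix \<eta> u
    assume small: "\<forall>x\<in>k. energy (cutoff \<eta>) x < e / 4" and "u \<in> S"
    then obtain x where x: "x \<in> k" "dist x u < r"
      using k(2) by auto
    have "energy (cutoff \<eta>) (u - x) \<le> (norm (u - x))\<^sup>2"
      by (rule energy_le_norm[OF unit_weight_cutoff])
    also have "\<dots> \<le> r\<^sup>2"
      using x(2) by (intro power_mono) (simp_all add: dist_norm norm_minus_commute)
    finally show "energy (cutoff \<eta>) u < e"
      using energy_add_le[OF unit_weight_cutoff, of \<eta> x "u - x"] small x(1) r(2) by fastforce
  qed
qed

section \<open>Precompactness by truncation to finitely many coordinates\<close>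

lift_definition basis_ell2 :: "int \<Rightarrow> ell2" is "\<lambda>i j. of_bool (i = j)"
proof -
  fix i :: int
  have "(\<lambda>j. (of_bool (i = j) :: real)\<^sup>2) summable_on {i}"
    by simp
  then show "(\<lambda>j. (of_bool (i = j) :: real)\<^sup>2) summable_on UNIV"
    by (rule summable_on_cong_neutral[THEN iffD1, rotated -1]) auto
qed

text \<open>Each new index adds a segment: the box is the Minkowski sum of that segment and the box
  of lower dimension.\<close>

lemma compact_finite_box:
  assumes "finite A"
  shows "compact {\<Sum>i\<in>A. c i *\<^sub>R basis_ell2 i |c. \<forall>i. \<bar>c i\<bar> \<le> B}"
  using assms
proof (induction A)
  case empty
  have "{\<Sum>i\<in>{}. c i *\<^sub>R basis_ell2 i |c. \<forall>i. \<bar>c i\<bar> \<le> B} \<subseteq> {0}"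
    by auto
  then show ?case
    by (meson finite.emptyI finite.insertI finite_imp_compact finite_subset)
next
  case (insert a A)
  let ?S = "\<lambda>A. {\<Sum>i\<in>A. c i *\<^sub>R basis_ell2 i |c. \<forall>i. \<bar>c i\<bar> \<le> B}"
  have "compact ((\<lambda>r. r *\<^sub>R basis_ell2 a) ` {- B..B})"
    by (intro compact_continuous_image continuous_intros compact_Icc)
  then have "compact {x + y |x y. x \<in> (\<lambda>r. r *\<^sub>R basis_ell2 a) ` {- B..B} \<and> y \<in> ?S A}"
    using insert.IH by (rule compact_sums)
  moreover have "{x + y |x y. x \<in> (\<lambda>r. r *\<^sub>R basis_ell2 a) ` {- B..B} \<and> y \<in> ?S A} = ?S (insert a A)"
  proof (intro equalityI subsetI)
    fix z
    assume "z \<in> {x + y |x y. x \<in> (\<lambda>r. r *\<^sub>R basis_ell2 a) ` {- B..B} \<and> y \<in> ?S A}"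
    then obtain r c where rc: "r \<in> {- B..B}" "\<forall>i. \<bar>c i\<bar> \<le> B"
      "z = r *\<^sub>R basis_ell2 a + (\<Sum>i\<in>A. c i *\<^sub>R basis_ell2 i)"
      by blast
    have "(\<Sum>i\<in>A. c i *\<^sub>R basis_ell2 i) = (\<Sum>i\<in>A. (c(a := r)) i *\<^sub>R basis_ell2 i)"
      using insert.hyps by (intro sum.cong) auto
    then have "z = (\<Sum>i\<in>insert a A. (c(a := r)) i *\<^sub>R basis_ell2 i)"
      using insert.hyps rc(3) by simp
    moreover have "\<forall>i. \<bar>(c(a := r)) i\<bar> \<le> B"
      using rc(1,2) by auto
    ultimately show "z \<in> ?S (insert a A)"
      by blast
  next
    fix z
    assume "z \<in> ?S (insert a A)"
    then obtain c where c: "\<forall>i. \<bar>c i\<bar> \<le> B" "z = (\<Sum>i\<in>insert a A. c i *\<^sub>R basis_ell2 i)"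
      by blast
    then have "z = c a *\<^sub>R basis_ell2 a + (\<Sum>i\<in>A. c i *\<^sub>R basis_ell2 i)"
      using insert.hyps by simp
    moreover have "c a \<in> {- B..B}"
      using c(1) by (simp add: abs_le_iff minus_le_iff)
    ultimately show "z \<in> {x + y |x y. x \<in> (\<lambda>r. r *\<^sub>R basis_ell2 a) ` {- B..B} \<and> y \<in> ?S A}"
      using c(1) by blast
  qed
  ultimately show ?case
    by simp
qed

text \<open>Truncation to \<open>{- n..n}\<close> lands in a compact box because coordinates are at
  most \<open>B\<close>, and it changes each element of \<open>S\<close> by less than
  \<open>r\<close>. A finite net of the box is thus a net of \<open>S\<close>.\<close>

lemma compact_closure_if_uniformly_small_tails:
  assumes bound: "\<And>u. u \<in> S \<Longrightarrow> norm u \<le> B" and tails: "uniformly_small_tails S"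
  shows "compact (closure S)"
  unfolding compact_eq_totally_bounded
proof (intro conjI allI impI)
  show "complete (closure S)"
    by (simp add: complete_eq_closed)
  fix e :: real
  assume e: "0 < e"
  \<comment> \<open>One \<open>r\<close> for truncating and one for the net; the third is slack for
    replacing the closed balls, which cover the closure, by open ones.\<close>
  define r where "r = e / 3"
  have r: "0 < r" "r + r < e"
    using e by (simp_all add: r_def)
  have "\<forall>\<^sub>F \<eta> in at_right 0. (\<forall>u\<in>S. energy (cutoff \<eta>) u < r\<^sup>2) \<and> 0 < \<eta>"
    using tails r unfolding uniformly_small_tails_def
    by (intro eventually_conj eventually_at_right_less) simp
  then obtain \<eta> where \<eta>: "0 < \<eta>" "\<And>u. u \<in> S \<Longrightarrow> energy (cutoff \<eta>) u < r\<^sup>2"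
    using eventually_happens'[OF trivial_limit_at_right_real] by blast
  \<comment> \<open>Beyond \<open>2 / \<eta>\<close> the cutoff equals 1, so the weighted energy
    dominates the squared norm of the discarded part.\<close>
  define n where "n = \<lceil>2 / \<eta>\<rceil>"
  define A where "A = {- n..n}"
  let ?K = "{\<Sum>i\<in>A. c i *\<^sub>R basis_ell2 i |c. \<forall>i. \<bar>c i\<bar> \<le> B}"
  have near: "\<exists>p\<in>?K. dist p u < r" if u: "u \<in> S" for u
  proof -
    let ?p = "\<Sum>i\<in>A. coord u i *\<^sub>R basis_ell2 i"
    have p: "coord ?p i = (if i \<in> A then coord u i else 0)" for i
      by (simp add: basis_ell2.rep_eq of_bool_def A_def sum.delta if_distrib cong: if_cong)
    have "coord (u - ?p) i * coord (u - ?p) i \<le> coord u i * coord (weighted (cutoff \<eta>) u) i" for i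
    proof (cases "i \<in> A")
      case True
      then show ?thesis
        using unit_weight_cutoff[of \<eta>] unfolding coord_minus p
        by (simp add: coord_weighted unit_weight_def mult.left_commute[of "coord u i"])
    next
      case False
      then have "2 / \<eta> \<le> \<bar>real_of_int i\<bar>"
        unfolding A_def n_def by (simp add: ceiling_le_iff less_ceiling_iff) linarith
      then have "2 \<le> \<eta> * \<bar>real_of_int i\<bar>"
        using \<eta>(1) by (simp add: divide_le_eq mult.commute)
      then have "cutoff \<eta> i = 1"
        by (simp add: cutoff_def)
      then show ?thesis
        using False unfolding coord_minus p by (simp add: coord_weighted[OF unit_weight_cutoff])
    qed
    then have "(norm (u - ?p))\<^sup>2 \<le> energy (cutoff \<eta>) u"
      unfolding power2_norm_eq_inner energy_def by (rule inner_mono_coord)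
    also have "\<dots> < r\<^sup>2"
      by (rule \<eta>(2)[OF u])
    finally have "norm (u - ?p) < r"
      by (rule power_less_imp_less_base) (use r in simp)
    moreover have "\<forall>i. \<bar>coord u i\<bar> \<le> B"
      using abs_coord_le bound[OF u] order_trans by blast
    then have "?p \<in> ?K"
      by blast
    ultimately show ?thesis
      by (intro bexI[of _ ?p]) (simp_all add: dist_norm norm_minus_commute)
  qed
  have "compact ?K"
    by (rule compact_finite_box) (simp add: A_def)
  then obtain k where k: "finite k" "?K \<subseteq> (\<Union>x\<in>k. ball x r)"
    using r(1) unfolding compact_eq_totally_bounded by blast
  have "S \<subseteq> (\<Union>x\<in>k. cball x (r + r))"
  proof
    fix u
    assume "u \<in> S"
    then obtain p where p: "p \<in> ?K" "dist p u < r"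
      using near by blast
    then obtain x where "x \<in> k" "dist x p < r"
      using k(2) by auto
    with p(2) show "u \<in> (\<Union>x\<in>k. cball x (r + r))"
      using dist_triangle[of x u p] by (force simp: mem_cball)
  qed
  then have "closure S \<subseteq> (\<Union>x\<in>k. cball x (r + r))"
    by (rule closure_minimal) (intro closed_UN k(1) ballI closed_cball)
  also have "\<dots> \<subseteq> (\<Union>x\<in>k. ball x e)"
    using r(2) by auto
  finally show "\<exists>k. finite k \<and> closure S \<subseteq> (\<Union>x\<in>k. ball x e)"
    using k(1) by blast
qed

section \<open>The hull\<close>

lemma at_time_shift [simp]: "at_time (shift h f) t = at_time f (t + h)"
  by (simp add: shift.rep_eq)

lemma curve_eqI: "(\<And>t. at_time f t = at_time g t) \<Longrightarrow> f = g"
  by (simp add: at_time_inject[symmetric] fun_eq_iff)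

lemma shift_zero [simp]: "shift 0 f = f"
  by (rule curve_eqI) simp

lemma shift_shift [simp]: "shift s (shift t f) = shift (s + t) f"
  by (rule curve_eqI) (simp add: add.assoc)

text \<open>Since \<open>inverse L\<close> is at least \<open>e\<close>, the minimum in the metric
  can fall below \<open>e\<close> only through the supremum over \<open>{- L..L}\<close>.\<close>

lemma dist_at_time_less:
  assumes "dist f g < e" "e \<le> inverse L" "0 < L" "\<bar>s\<bar> \<le> L"
  shows "dist (at_time f s) (at_time g s) < e"
  using le_dist_curve[OF assms(3), of f g] le_SUP_dist_at_time[OF assms(4), of f g] assms(1,2)
  by linarith

text \<open>Windows longer than \<open>inverse e\<close> contribute at most
  \<open>inverse L\<close>, which is below \<open>e\<close>; only the shorter ones have to be
  controlled.\<close>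

lemma dist_curve_leI:
  fixes f g :: "'a::metric_space curve"
  assumes "0 < e" and le: "\<And>s. \<bar>s\<bar> \<le> inverse e \<Longrightarrow> dist (at_time f s) (at_time g s) \<le> e"
  shows "dist f g \<le> e"
  unfolding dist_curve_def
proof (rule cSUP_least)
  fix L :: real
  assume L: "L \<in> {0<..}"
  show "min (SUP t\<in>{- L..L}. dist (at_time f t) (at_time g t)) (inverse L) \<le> e"
  proof (cases "L \<le> inverse e")
    case True
    have "(SUP t\<in>{- L..L}. dist (at_time f t) (at_time g t)) \<le> e"
      by (rule cSUP_least) (use L True in \<open>auto intro: le\<close>)
    then show ?thesis
      by linarith
  next
    case False
    then have "inverse L \<le> inverse (inverse e)"
      using assms(1) by (intro le_imp_inverse_le) auto
    then show ?thesis
      by simp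
  qed
qed simp

lemma continuous_on_shift:
  fixes S :: "'a::metric_space curve set"
  shows "continuous_on S (shift t)"
  unfolding continuous_on_iff
proof (intro ballI allI impI)
  fix f :: "'a curve" and e :: real
  assume e: "0 < e"
  \<comment> \<open>A distance of \<open>e / 2\<close> is decided on the window of half-width
    \<open>inverse (e / 2)\<close>; the shift needs it wider by the modulus of
    \<open>t\<close>.\<close>
  define L where "L = inverse (e / 2) + \<bar>t\<bar>"
  have L: "0 < L"
    using e by (simp add: L_def add_pos_nonneg)
  have "dist (shift t g) (shift t f) < e" if "dist g f < min (e / 2) (inverse L)" for g
  proof -
    have "dist (shift t g) (shift t f) \<le> e / 2"
    proof (rule dist_curve_leI)
      fix s
      assume "\<bar>s\<bar> \<le> inverse (e / 2)"
      then have "\<bar>s + t\<bar> \<le> L"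
        unfolding L_def by linarith
      from dist_at_time_less[OF that min.cobounded2 L this]
      show "dist (at_time (shift t g) s) (at_time (shift t f) s) \<le> e / 2"
        by simp
    qed (use e in simp)
    then show ?thesis
      using e by simp
  qed
  then show "\<exists>d>0. \<forall>g\<in>S. dist g f < d \<longrightarrow> dist (shift t g) (shift t f) < e"
    using e L by (intro exI[of _ "min (e / 2) (inverse L)"]) simp
qed

lemma continuous_on_at_time_curve:
  fixes S :: "'a::metric_space curve set"
  shows "continuous_on S (\<lambda>f. at_time f t)"
  unfolding continuous_on_iff
proof (intro ballI allI impI)
  fix f :: "'a curve" and e :: real
  assume e: "0 < e"
  have "dist (at_time g t) (at_time f t) < e" if "dist g f < min e (inverse (\<bar>t\<bar> + 1))" for g
    using dist_at_time_less[OF that min.cobounded2] by simp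
  then show "\<exists>d>0. \<forall>g\<in>S. dist g f < d \<longrightarrow> dist (at_time g t) (at_time f t) < e"
    using e by (intro exI[of _ "min e (inverse (\<bar>t\<bar> + 1))"]) simp
qed

lemma shift_in_curve_hull:
  assumes "g \<in> curve_hull f"
  shows "shift t g \<in> curve_hull f"
proof -
  have "shift t ` closure (range (\<lambda>h. shift h f)) \<subseteq> closure (range (\<lambda>h. shift h f))"
    by (rule image_closure_subset)
      (auto intro: continuous_on_shift subsetD[OF closure_subset])
  then show ?thesis
    using assms unfolding curve_hull_def by blast
qed

section \<open>Solutions of the lattice equation\<close>

lemma energy_has_real_derivative:
  assumes \<theta>: "unit_weight \<theta>" and u: "(u has_vector_derivative u') (at t within S)"
  shows "((\<lambda>t. energy \<theta> (u t)) has_real_derivative 2 * inner u' (weighted \<theta> (u t))) (at t within S)"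
proof -
  have "((\<lambda>t. weighted \<theta> (u t)) has_vector_derivative weighted \<theta> u') (at t within S)"
    by (rule bounded_linear.has_vector_derivative[OF bounded_linear_weighted[OF \<theta>] u])
  from bounded_bilinear.has_vector_derivative[OF bounded_bilinear_inner u this]
  show ?thesis
    using inner_weighted_commute[OF \<theta>, of "u t" u']
    by (simp add: energy_def has_real_derivative_iff_has_vector_derivative)
qed

text \<open>The sign condition has a form that truncations of \<open>F\<close> inherit, so that the
  locale can be interpreted a second time, with the truncated nonlinearity, when solutions are
  constructed.\<close>

locale lattice_system =
  fixes \<nu> lam :: real and F :: "real \<Rightarrow> real"
  assumes nu_pos: "0 < \<nu>" and lam_pos: "0 < lam"
    and F_zero: "F 0 = 0"
    and F_lipschitz: "\<And>B. bounded B \<Longrightarrow> \<exists>K. K-lipschitz_on B F"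
    and F_sign: "\<And>s. s * F s \<le> 0"
begin

definition field :: "ell2 \<Rightarrow> ell2"
  where "field u = \<nu> *\<^sub>R laplacian u - lam *\<^sub>R u + superposition F u"

lemma coord_superposition_F [simp]: "coord (superposition F u) i = F (coord u i)"
  using F_zero F_lipschitz by (rule coord_superposition)

lemma solution_field:
  "lattice_solution \<nu> lam F v g u \<longleftrightarrow> u 0 = v \<and>
    (\<forall>t\<ge>0. (u has_vector_derivative field (u t) + at_time g t) (at t within {0..}))"
  by (simp add: lattice_solution_def field_def)

text \<open>The range \<open>X\<close> makes one estimate serve twice: a ball gives the local
  Lipschitz bound, and \<open>UNIV\<close> the global one for the truncated field.\<close>

lemma norm_field_diff_le:
  assumes "K-lipschitz_on X F" "\<And>i. coord u i \<in> X" "\<And>i. coord v i \<in> X"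
  shows "norm (field u - field v) \<le> (4 * \<nu> + lam + K) * norm (u - v)"
proof -
  have "norm (superposition F u - superposition F v) \<le> K * norm (u - v)"
    by (rule norm_le_norm_coord)
      (use assms lipschitz_onD[OF assms(1)] in \<open>auto simp: dist_real_def intro: lipschitz_on_nonneg\<close>)
  moreover have "norm (\<nu> *\<^sub>R laplacian (u - v)) \<le> \<nu> * (4 * norm (u - v))"
    using nu_pos norm_laplacian_le[of "u - v"] by simp
  moreover have "norm (lam *\<^sub>R (u - v)) = lam * norm (u - v)"
    using lam_pos by simp
  moreover have field_diff: "field u - field v =
      \<nu> *\<^sub>R laplacian (u - v) - lam *\<^sub>R (u - v) + (superposition F u - superposition F v)"
    by (simp add: field_def laplacian_diff algebra_simps)
  ultimately have "norm (field u - field v) \<le> \<nu> * (4 * norm (u - v)) + lam * norm (u - v) + K * norm (u - v)"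
    unfolding field_diff using norm_triangle_ineq[of "\<nu> *\<^sub>R laplacian (u - v) - lam *\<^sub>R (u - v)" "superposition F u - superposition F v"]
      norm_triangle_ineq4[of "\<nu> *\<^sub>R laplacian (u - v)" "lam *\<^sub>R (u - v)"] by linarith
  then show ?thesis
    by (simp add: algebra_simps)
qed

lemma field_lipschitz_on_bounded:
  "\<exists>K\<ge>0. \<forall>u v. norm u \<le> R \<longrightarrow> norm v \<le> R \<longrightarrow> norm (field u - field v) \<le> K * norm (u - v)"
proof -
  obtain K where K: "K-lipschitz_on (cball 0 R) F"
    using F_lipschitz bounded_cball by blast
  have "coord u i \<in> cball 0 R" if "norm u \<le> R" for u i
    using abs_coord_le[of u i] that by simp
  then have "norm (field u - field v) \<le> (4 * \<nu> + lam + K) * norm (u - v)"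
    if "norm u \<le> R" "norm v \<le> R" for u v
    using norm_field_diff_le[OF K] that by blast
  moreover have "0 \<le> 4 * \<nu> + lam + K"
    using lipschitz_on_nonneg[OF K] nu_pos lam_pos by simp
  ultimately show ?thesis
    by blast
qed

section \<open>A priori estimates along solutions\<close>

text \<open>The damping supplies \<open>- 2 * lam\<close> times the energy. Young's inequality with
  parameter \<open>lam\<close> spends half of it on the forcing, which leaves the rate
  \<open>lam\<close>; the nonlinear term is nonpositive in every coordinate.\<close>

lemma energy_growth:
  assumes \<theta>: "unit_weight \<theta>" and concave: "\<And>i. (\<theta> (i - 1) + \<theta> (i + 1)) / 2 - \<theta> i \<le> \<eta>"
  shows "2 * inner (field u + k) (weighted \<theta> u)
    \<le> - lam * energy \<theta> u + (2 * \<nu> * \<eta> * (norm u)\<^sup>2 + energy \<theta> k / lam)"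
proof -
  have "inner (superposition F u) (weighted \<theta> u) \<le> inner 0 (0 :: ell2)"
  proof (rule inner_mono_coord)
    fix i
    have "\<theta> i * (coord u i * F (coord u i)) \<le> 0"
      using \<theta> by (intro mult_nonneg_nonpos[OF _ F_sign]) (simp add: unit_weight_def)
    then show "coord (superposition F u) i * coord (weighted \<theta> u) i \<le> coord 0 i * coord 0 i"
      by (simp add: coord_weighted[OF \<theta>] ac_simps)
  qed
  moreover have "\<nu> * inner (laplacian u) (weighted \<theta> u) \<le> \<nu> * (\<eta> * (norm u)\<^sup>2)"
    using nu_pos by (intro mult_left_mono inner_laplacian_weighted_le[OF \<theta> concave]) simp
  moreover have "2 * inner k (weighted \<theta> u) \<le> energy \<theta> k / lam + lam * energy \<theta> u"
    by (rule inner_weighted_young[OF \<theta> lam_pos])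
  moreover have "inner (field u + k) (weighted \<theta> u) = \<nu> * inner (laplacian u) (weighted \<theta> u)
      - lam * energy \<theta> u + inner (superposition F u) (weighted \<theta> u) + inner k (weighted \<theta> u)"
    by (simp add: field_def energy_def inner_simps)
  ultimately show ?thesis
    by simp
qed

lemma energy_bound:
  assumes u: "lattice_solution \<nu> lam F v g u"
    and \<theta>: "unit_weight \<theta>" and concave: "\<And>i. (\<theta> (i - 1) + \<theta> (i + 1)) / 2 - \<theta> i \<le> \<eta>"
    and T: "0 \<le> T" and b: "0 \<le> b"
    and bound: "\<And>s. 0 \<le> s \<Longrightarrow> s \<le> T \<Longrightarrow>
      2 * \<nu> * \<eta> * (norm (u s))\<^sup>2 + energy \<theta> (at_time g s) / lam \<le> b"
  shows "energy \<theta> (u T) \<le> exp (- lam * T) * energy \<theta> v + b / lam"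
proof -
  have "energy \<theta> (u T) \<le> exp (- lam * T) * (energy \<theta> (u 0) + b / - lam) - b / - lam"
  proof (rule gronwall[OF _ _ _ T])
    fix t
    assume t: "0 \<le> t" "t \<le> T"
    show "((\<lambda>t. energy \<theta> (u t)) has_real_derivative
        2 * inner (field (u t) + at_time g t) (weighted \<theta> (u t))) (at t within {0..})"
      using u t by (intro energy_has_real_derivative \<theta>) (simp add: solution_field)
    show "2 * inner (field (u t) + at_time g t) (weighted \<theta> (u t)) \<le> - lam * energy \<theta> (u t) + b"
      using energy_growth[OF \<theta> concave, where u = "u t" and k = "at_time g t"] bound[OF t] by linarith
  qed (use lam_pos in simp)
  also have "\<dots> \<le> exp (- lam * T) * energy \<theta> v + b / lam"
    using u lam_pos b by (simp add: solution_field algebra_simps)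
  finally show ?thesis .
qed

text \<open>The constant weight has discrete Laplacian 0, hence \<eta> = 0 and only the forcing
  contributes.\<close>

lemma norm_bound:
  assumes u: "lattice_solution \<nu> lam F v g u" and C: "\<And>t. norm (at_time g t) \<le> C" and T: "0 \<le> T"
  shows "(norm (u T))\<^sup>2 \<le> exp (- lam * T) * (norm v)\<^sup>2 + (C / lam)\<^sup>2"
proof -
  have "energy (\<lambda>_. 1) (u T) \<le> exp (- lam * T) * energy (\<lambda>_. 1) v + C\<^sup>2 / lam / lam"
    by (rule energy_bound[OF u, where \<eta> = 0])
      (use lam_pos T C in \<open>auto simp: unit_weight_def intro!: divide_right_mono power_mono\<close>)
  then show ?thesis
    by (simp add: power_divide power2_eq_square)
qed

lemma norm_bound_initial:
  assumes "lattice_solution \<nu> lam F v g u" "\<And>t. norm (at_time g t) \<le> C" "0 \<le> T"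
  shows "(norm (u T))\<^sup>2 \<le> (norm v)\<^sup>2 + (C / lam)\<^sup>2"
proof -
  have "exp (- lam * T) * (norm v)\<^sup>2 \<le> 1 * (norm v)\<^sup>2"
    using lam_pos assms(3) by (intro mult_right_mono) auto
  then show ?thesis
    using norm_bound[OF assms] by linarith
qed

section \<open>Dependence on the data, uniqueness and existence\<close>

text \<open>\<open>K\<close> depends on \<open>R\<close> alone. With equal data and
  \<open>d = 0\<close> this is uniqueness; with \<open>d\<close> the distance of the forcings on
  \<open>{0..T}\<close> it gives joint continuity of the cocycle.\<close>

lemma stability:
  "\<exists>K>0. \<forall>u1 u2 v1 v2 g1 g2 T d. lattice_solution \<nu> lam F v1 g1 u1 \<longrightarrow> lattice_solution \<nu> lam F v2 g2 u2 \<longrightarrow>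
    0 \<le> T \<longrightarrow> (\<forall>s\<in>{0..T}. norm (u1 s) \<le> R \<and> norm (u2 s) \<le> R \<and> dist (at_time g1 s) (at_time g2 s) \<le> d) \<longrightarrow>
    (dist (u1 T) (u2 T))\<^sup>2 \<le> exp (K * T) * ((dist v1 v2)\<^sup>2 + d\<^sup>2)"
proof -
  obtain L where L: "0 \<le> L"
    "\<And>u v. norm u \<le> R \<Longrightarrow> norm v \<le> R \<Longrightarrow> norm (field u - field v) \<le> L * norm (u - v)"
    using field_lipschitz_on_bounded[of R] by blast
  \<comment> \<open>\<open>2 * L\<close> comes from the field and 1 from splitting the product of
    \<open>d\<close> and the norm of \<open>w t\<close>. As \<open>K\<close> is at least 1,
    \<open>d\<^sup>2 / K\<close> is at most \<open>d\<^sup>2\<close>.\<close>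
  define K where "K = 2 * L + 1"
  have K: "1 \<le> K"
    using L(1) by (simp add: K_def)
  have "(dist (u1 T) (u2 T))\<^sup>2 \<le> exp (K * T) * ((dist v1 v2)\<^sup>2 + d\<^sup>2)"
    if u: "lattice_solution \<nu> lam F v1 g1 u1" "lattice_solution \<nu> lam F v2 g2 u2" and T: "0 \<le> T"
      and R: "\<forall>s\<in>{0..T}. norm (u1 s) \<le> R \<and> norm (u2 s) \<le> R \<and> dist (at_time g1 s) (at_time g2 s) \<le> d"
    for u1 u2 v1 v2 g1 g2 T d
  proof -
    define w where "w t = u1 t - u2 t" for t
    define w' where "w' t = (field (u1 t) - field (u2 t)) + (at_time g1 t - at_time g2 t)" for t
    have "energy (\<lambda>_. 1) (w T) \<le> exp (K * T) * (energy (\<lambda>_. 1) (w 0) + d\<^sup>2 / K) - d\<^sup>2 / K"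
    proof (rule gronwall[OF _ _ _ T])
      fix t
      assume t: "0 \<le> t" "t \<le> T"
      have "(w has_vector_derivative w' t) (at t within {0..})"
        using has_vector_derivative_diff[of u1 _ "at t within {0..}" u2] u t
        unfolding w_def w'_def solution_field by (fastforce simp: algebra_simps)
      then show "((\<lambda>t. energy (\<lambda>_. 1) (w t)) has_real_derivative 2 * inner (w' t) (weighted (\<lambda>_. 1) (w t)))
          (at t within {0..})"
        by (intro energy_has_real_derivative) (simp_all add: unit_weight_def)
      have "norm (w' t) \<le> L * norm (w t) + d"
      proof -
        have "norm (field (u1 t) - field (u2 t)) \<le> L * norm (w t)"
          unfolding w_def using R t by (intro L(2)) auto
        moreover have "norm (at_time g1 t - at_time g2 t) \<le> d"
          using R t by (auto simp: dist_norm)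
        ultimately show ?thesis
          unfolding w'_def by (intro order_trans[OF norm_triangle_ineq add_mono])
      qed
      then have "inner (w' t) (w t) \<le> (L * norm (w t) + d) * norm (w t)"
        by (intro order_trans[OF norm_cauchy_schwarz mult_right_mono]) auto
      moreover have "2 * (d * norm (w t)) \<le> d\<^sup>2 + (norm (w t))\<^sup>2"
        using sum_squares_bound[of d "norm (w t)"] by simp
      ultimately show "2 * inner (w' t) (weighted (\<lambda>_. 1) (w t)) \<le> K * energy (\<lambda>_. 1) (w t) + d\<^sup>2"
        by (simp add: K_def power2_eq_square algebra_simps)
    qed (use K in simp)
    also have "\<dots> \<le> exp (K * T) * ((dist v1 v2)\<^sup>2 + d\<^sup>2)"
    proof -
      have "d\<^sup>2 / K \<le> d\<^sup>2" "0 \<le> d\<^sup>2 / K"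
        using K by (simp_all add: divide_le_eq mult_le_cancel_left1)
      moreover from this have "exp (K * T) * ((dist v1 v2)\<^sup>2 + d\<^sup>2 / K) \<le> exp (K * T) * ((dist v1 v2)\<^sup>2 + d\<^sup>2)"
        by simp
      moreover have w0: "energy (\<lambda>_. 1) (w 0) = (dist v1 v2)\<^sup>2"
        using u by (simp add: w_def solution_field dist_norm)
      ultimately show ?thesis
        unfolding w0 by linarith
    qed
    finally show ?thesis
      by (simp add: w_def dist_norm)
  qed
  then show ?thesis
    using K by (intro exI[of _ K] conjI) (linarith, blast)
qed

lemma solution_continuous:
  assumes "lattice_solution \<nu> lam F v g u"
  shows "continuous_on {0..} u"
  unfolding continuous_on_eq_continuous_within
proof
  fix t :: real
  assume "t \<in> {0..}"
  then have "(u has_vector_derivative field (u t) + at_time g t) (at t within {0..})"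
    using assms by (simp add: solution_field)
  then show "continuous (at t within {0..}) u"
    by (rule has_vector_derivative_continuous)
qed

lemma solution_unique:
  assumes u1: "lattice_solution \<nu> lam F v g u1" and u2: "lattice_solution \<nu> lam F v g u2" and T: "0 \<le> T"
  shows "u1 T = u2 T"
proof -
  have "compact ((u1 ` {0..T}) \<union> (u2 ` {0..T}))"
    by (intro compact_Un compact_continuous_image compact_Icc
        continuous_on_subset[OF solution_continuous[OF u1]]
        continuous_on_subset[OF solution_continuous[OF u2]]) auto
  then obtain R where R: "\<And>x. x \<in> u1 ` {0..T} \<union> u2 ` {0..T} \<Longrightarrow> norm x \<le> R"
    using compact_imp_bounded bounded_iff by metis
  obtain K where K: "\<And>u1 u2 v1 v2 g1 g2 T d. lattice_solution \<nu> lam F v1 g1 u1 \<Longrightarrow>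
    lattice_solution \<nu> lam F v2 g2 u2 \<Longrightarrow> 0 \<le> T \<Longrightarrow>
    \<forall>s\<in>{0..T}. norm (u1 s) \<le> R \<and> norm (u2 s) \<le> R \<and> dist (at_time g1 s) (at_time g2 s) \<le> d \<Longrightarrow>
    (dist (u1 T) (u2 T))\<^sup>2 \<le> exp (K * T) * ((dist v1 v2)\<^sup>2 + d\<^sup>2)"
    using stability[of R] by metis
  have "(dist (u1 T) (u2 T))\<^sup>2 \<le> exp (K * T) * ((dist v v)\<^sup>2 + 0\<^sup>2)"
    by (rule K[OF u1 u2 T]) (use R in auto)
  then show ?thesis
    by simp
qed

text \<open>Truncating \<open>F\<close> outside \<open>{- R..R}\<close> makes the field globally Lipschitz and keeps the sign
  condition; the a priori bound then keeps the solution where the truncation is not active.\<close>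

lemma solution_exists:
  assumes C: "\<And>t. norm (at_time g t) \<le> C"
  shows "\<exists>u. lattice_solution \<nu> lam F v g u"
proof -
  \<comment> \<open>The a priori bound involves \<open>v\<close>, \<open>C\<close> and
    \<open>lam\<close> but not the nonlinearity, so the level can be fixed before truncating. Adding
    1 makes it positive.\<close>
  define R where "R = sqrt ((norm v)\<^sup>2 + (C / lam)\<^sup>2) + 1"
  have R: "0 < R"
    by (simp add: R_def add_nonneg_pos)
  define clamp where "clamp s = max (- R) (min R s)" for s
  define G where "G s = F (clamp s)" for s
  obtain K where K: "K-lipschitz_on {- R..R} F"
    using F_lipschitz[of "{- R..R}"] by auto
  have K_UNIV: "K-lipschitz_on UNIV G"
  proof (rule lipschitz_onI)
    fix s t
    have "dist (G s) (G t) \<le> K * dist (clamp s) (clamp t)"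
      unfolding G_def by (rule lipschitz_onD[OF K]) (use R in \<open>auto simp: clamp_def\<close>)
    also have "dist (clamp s) (clamp t) \<le> dist s t"
      by (simp add: clamp_def dist_real_def)
    finally show "dist (G s) (G t) \<le> K * dist s t"
      using lipschitz_on_nonneg[OF K] by (simp add: mult_left_mono)
  qed (rule lipschitz_on_nonneg[OF K])
  have "s * G s \<le> 0" for s
  proof (cases "clamp s = 0")
    case True
    then show ?thesis
      by (simp add: G_def F_zero)
  next
    case False
    \<comment> \<open>Clamping keeps the sign, so the sign condition at \<open>clamp s\<close> is
      only multiplied by a nonnegative factor.\<close>
    have "s * F (clamp s) = s / clamp s * (clamp s * F (clamp s))"
      using False by simp
    also have "\<dots> \<le> 0"
    proof (rule mult_nonneg_nonpos[OF _ F_sign])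
      show "0 \<le> s / clamp s"
        using R by (auto simp: clamp_def zero_le_divide_iff)
    qed
    finally show ?thesis
      by (simp add: G_def)
  qed
  moreover have "\<exists>K. K-lipschitz_on B G" for B
    using lipschitz_on_subset[OF K_UNIV subset_UNIV] by (rule exI)
  moreover have "G 0 = 0"
    using R F_zero by (simp add: G_def clamp_def)
  ultimately interpret G: lattice_system \<nu> lam G
    using nu_pos lam_pos by unfold_locales
  have "(4 * \<nu> + lam + K)-lipschitz_on UNIV G.field"
    using G.norm_field_diff_le[OF K_UNIV] lipschitz_on_nonneg[OF K] nu_pos lam_pos
    by (intro lipschitz_onI) (simp_all add: dist_norm)
  from lipschitz_initial_value_problem[OF this continuous_on_at_time C, of v]
  obtain u where u: "lattice_solution \<nu> lam G v g u"
    unfolding G.solution_field by blast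
  have "superposition G (u t) = superposition F (u t)" if t: "0 \<le> t" for t
  proof (rule ell2_eqI)
    fix i
    have "norm (u t) \<le> sqrt ((norm v)\<^sup>2 + (C / lam)\<^sup>2)"
      using G.norm_bound_initial[OF u C t] by (rule real_le_rsqrt)
    then have "\<bar>coord (u t) i\<bar> \<le> R"
      using abs_coord_le[of "u t" i] by (simp add: R_def)
    then have "clamp (coord (u t) i) = coord (u t) i"
      unfolding clamp_def by linarith
    then show "coord (superposition G (u t)) i = coord (superposition F (u t)) i"
      by (simp add: G_def)
  qed
  then have "lattice_solution \<nu> lam F v g u"
    using u by (simp add: lattice_solution_def)
  then show ?thesis
    by blast
qed

lemma lattice_cocycle_solution:
  assumes u: "lattice_solution \<nu> lam F v g u" and t: "0 \<le> t"
  shows "lattice_cocycle \<nu> lam F t v g = u t"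
  unfolding lattice_cocycle_def
proof (rule the_equality)
  show "\<exists>w. lattice_solution \<nu> lam F v g w \<and> w t = u t"
    using u by (intro exI[of _ u]) simp
next
  fix x
  assume "\<exists>w. lattice_solution \<nu> lam F v g w \<and> w t = x"
  then show "x = u t"
    using solution_unique[OF _ u t] by (elim exE conjE) simp
qed

lemma solution_shift:
  assumes u: "lattice_solution \<nu> lam F v g u" and h: "0 \<le> h"
  shows "lattice_solution \<nu> lam F (u h) (shift h g) (\<lambda>t. u (t + h))"
  unfolding solution_field
proof (intro conjI allI impI)
  fix t :: real
  assume t: "0 \<le> t"
  have "(u has_vector_derivative field (u (t + h)) + at_time g (t + h)) (at (t + h) within {0..})"
    using u t h by (simp add: solution_field)
  then have "(u has_vector_derivative field (u (t + h)) + at_time g (t + h))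
      (at (t + h) within (\<lambda>t. t + h) ` {0..})"
    by (rule has_vector_derivative_within_subset) (use h in auto)
  moreover have "((\<lambda>t. t + h) has_vector_derivative 1) (at t within {0..})"
    by (auto intro!: derivative_eq_intros)
  ultimately show "((\<lambda>t. u (t + h)) has_vector_derivative field (u (t + h)) + at_time (shift h g) t)
      (at t within {0..})"
    using vector_diff_chain_within[of "\<lambda>t. t + h" 1 t "{0..}" u] by (simp add: o_def)
qed simp

end

section \<open>The cocycle over a compact family of forcings\<close>

text \<open>For estimates along complete trajectories: a bound available from every starting time
  \<open>- m\<close>, with one constant \<open>c\<close>, loses its initial term.\<close>

lemma le_if_le_exp_sequence:
  fixes x a b c :: real
  assumes "0 < a" "\<And>m::nat. x \<le> exp (- a * real m) * c + b"
  shows "x \<le> b"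
proof (rule LIMSEQ_le_const)
  have "(\<lambda>m. exp (- a) ^ m) \<longlonglongrightarrow> 0"
    using assms(1) by (intro LIMSEQ_power_zero) simp
  then have "(\<lambda>m. exp (- a * real m)) \<longlonglongrightarrow> 0"
    by (simp add: exp_of_nat2_mult[symmetric] mult.commute)
  from tendsto_add[OF tendsto_mult_right[OF this, of c] tendsto_const[of b]]
  show "(\<lambda>m. exp (- a * real m) * c + b) \<longlonglongrightarrow> b"
    by simp
qed (intro exI allI impI assms(2))

locale forced_lattice_system = lattice_system +
  fixes Y :: "ell2 curve set"
  assumes compact_forcing: "compact Y" and shift_forcing: "g \<in> Y \<Longrightarrow> shift t g \<in> Y"
begin

abbreviation \<phi> :: "real \<Rightarrow> ell2 \<Rightarrow> ell2 curve \<Rightarrow> ell2"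
  where "\<phi> \<equiv> lattice_cocycle \<nu> lam F"

text \<open>Time 0 catches all times because \<open>Y\<close> is invariant under shifts. As a
  continuous image of \<open>Y\<close> the set is compact, which yields one norm bound and one tail
  estimate for all forcings and times.\<close>

definition forcing_values :: "ell2 set"
  where "forcing_values = (\<lambda>g. at_time g 0) ` Y"

lemma compact_forcing_values: "compact forcing_values"
  unfolding forcing_values_def
  by (intro compact_continuous_image continuous_on_at_time_curve compact_forcing)

lemma at_time_forcing: "g \<in> Y \<Longrightarrow> at_time g t \<in> forcing_values"
  using imageI[OF shift_forcing[of g t], of "\<lambda>g. at_time g 0"] by (simp add: forcing_values_def)

definition forcing_bound :: real
  where "forcing_bound = (SOME C. \<forall>k\<in>forcing_values. norm k \<le> C)"

lemma norm_forcing_le: "g \<in> Y \<Longrightarrow> norm (at_time g t) \<le> forcing_bound"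
proof -
  have "\<exists>C. \<forall>k\<in>forcing_values. norm k \<le> C"
    using compact_imp_bounded[OF compact_forcing_values] by (simp add: bounded_iff)
  then have "\<forall>k\<in>forcing_values. norm k \<le> forcing_bound"
    unfolding forcing_bound_def by (rule someI_ex)
  then show "g \<in> Y \<Longrightarrow> norm (at_time g t) \<le> forcing_bound"
    using at_time_forcing by blast
qed

definition radius_sq :: real
  where "radius_sq = (forcing_bound / lam)\<^sup>2"

lemma cocycle_solution:
  assumes "g \<in> Y"
  obtains u where "lattice_solution \<nu> lam F v g u" "\<And>t. 0 \<le> t \<Longrightarrow> \<phi> t v g = u t"
proof -
  obtain u where u: "lattice_solution \<nu> lam F v g u"
    using solution_exists[OF norm_forcing_le[OF assms]] by blast
  show thesis
    by (rule that[OF u lattice_cocycle_solution[OF u]])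
qed

sublocale cocycle \<phi> Y shift
proof
  fix g v and s t :: real
  assume g: "g \<in> Y"
  show "shift 0 g = g" "shift s (shift t g) = shift (s + t) g" "shift t g \<in> Y"
    using g by (simp_all add: shift_forcing)
  obtain u where u: "lattice_solution \<nu> lam F v g u" "\<And>t. 0 \<le> t \<Longrightarrow> \<phi> t v g = u t"
    using cocycle_solution[OF g] by blast
  show "\<phi> 0 v g = v"
    using u by (simp add: lattice_solution_def)
  assume "0 \<le> s" "0 \<le> t"
  then show "\<phi> (s + t) v g = \<phi> s (\<phi> t v g) (shift t g)"
    using u(2) lattice_cocycle_solution[OF solution_shift[OF u(1)]] by simp
qed

lemma norm_cocycle_le:
  assumes "g \<in> Y" "0 \<le> t"
  shows "(norm (\<phi> t v g))\<^sup>2 \<le> exp (- lam * t) * (norm v)\<^sup>2 + radius_sq"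
    and "(norm (\<phi> t v g))\<^sup>2 \<le> (norm v)\<^sup>2 + radius_sq"
proof -
  obtain u where u: "lattice_solution \<nu> lam F v g u" "\<And>t. 0 \<le> t \<Longrightarrow> \<phi> t v g = u t"
    using cocycle_solution[OF assms(1)] by blast
  show "(norm (\<phi> t v g))\<^sup>2 \<le> exp (- lam * t) * (norm v)\<^sup>2 + radius_sq"
    "(norm (\<phi> t v g))\<^sup>2 \<le> (norm v)\<^sup>2 + radius_sq"
    using norm_bound[OF u(1) norm_forcing_le[OF assms(1)] assms(2)]
      norm_bound_initial[OF u(1) norm_forcing_le[OF assms(1)] assms(2)] u(2)[OF assms(2)]
    by (simp_all add: radius_sq_def)
qed

text \<open>How small \<eta> must be depends on \<open>B\<close> and \<open>e\<close> but not on the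
  time, the state or the forcing. Coupling and forcing may each use half of \<open>e * lam\<close>,
  which \<open>energy_bound\<close> divides by \<open>lam\<close>; the forcing energy enters already
  divided by \<open>lam\<close>, hence the second factor in its threshold.\<close>

lemma eventually_tail_cocycle_le:
  assumes e: "0 < e"
  shows "\<forall>\<^sub>F \<eta> in at_right 0. \<forall>T\<ge>0. \<forall>v. \<forall>g\<in>Y. (norm v)\<^sup>2 \<le> B \<longrightarrow>
    energy (cutoff \<eta>) (\<phi> T v g) \<le> exp (- lam * T) * energy (cutoff \<eta>) v + e"
proof -
  have "((\<lambda>\<eta>. 2 * \<nu> * \<eta> * (B + radius_sq)) \<longlongrightarrow> 2 * \<nu> * 0 * (B + radius_sq)) (at_right 0)"
    by (intro tendsto_intros)
  then have "\<forall>\<^sub>F \<eta> in at_right 0. 2 * \<nu> * \<eta> * (B + radius_sq) < e * lam / 2"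
    by (rule order_tendstoD) (use e lam_pos in simp)
  moreover have "\<forall>\<^sub>F \<eta> in at_right 0. \<forall>k\<in>forcing_values. energy (cutoff \<eta>) k < e * lam / 2 * lam"
    by (rule uniformly_small_tailsD[OF compact_imp_uniformly_small_tails[OF compact_forcing_values]])
      (use e lam_pos in simp)
  moreover have "\<forall>\<^sub>F \<eta>::real in at_right 0. 0 < \<eta>"
    by (rule eventually_at_right_less)
  ultimately show ?thesis
  proof eventually_elim
    case (elim \<eta>)
    show ?case
    proof (intro allI ballI impI)
      fix T :: real and v :: ell2 and g :: "ell2 curve"
      assume T: "0 \<le> T" and g: "g \<in> Y" and v: "(norm v)\<^sup>2 \<le> B"
      obtain u where u: "lattice_solution \<nu> lam F v g u" "\<And>t. 0 \<le> t \<Longrightarrow> \<phi> t v g = u t"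
        using cocycle_solution[OF g] by blast
      have "energy (cutoff \<eta>) (u T) \<le> exp (- lam * T) * energy (cutoff \<eta>) v + e * lam / lam"
      proof (rule energy_bound[OF u(1) unit_weight_cutoff cutoff_laplacian_le T])
        fix s :: real
        assume s: "0 \<le> s" "s \<le> T"
        have "(norm (u s))\<^sup>2 \<le> B + radius_sq"
          using norm_cocycle_le(2)[OF g s(1), of v] v u(2)[OF s(1)] by simp
        then have "2 * \<nu> * \<eta> * (norm (u s))\<^sup>2 \<le> 2 * \<nu> * \<eta> * (B + radius_sq)"
          using nu_pos elim(3) by (intro mult_left_mono) auto
        moreover have "energy (cutoff \<eta>) (at_time g s) / lam \<le> e * lam / 2"
          using elim(2) at_time_forcing[OF g, of s] lam_pos by (simp add: divide_le_eq less_imp_le)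
        ultimately show "2 * \<nu> * \<eta> * (norm (u s))\<^sup>2 + energy (cutoff \<eta>) (at_time g s) / lam \<le> e * lam"
          using elim(1) by linarith
      qed (use elim(3) e lam_pos in auto)
      then show "energy (cutoff \<eta>) (\<phi> T v g) \<le> exp (- lam * T) * energy (cutoff \<eta>) v + e"
        using u(2)[OF T] lam_pos by simp
    qed
  qed
qed

text \<open>Initial tails are uniformly small because \<open>M\<close> is compact; the flow damps
  them and adds an error that is uniform in time.\<close>

lemma trajectories_in_compact:
  assumes M: "compact M"
  shows "\<exists>N. compact N \<and> (\<forall>t\<ge>0. \<forall>v\<in>M. \<forall>g\<in>Y. \<phi> t v g \<in> N)"
proof -
  obtain b where b: "\<And>v. v \<in> M \<Longrightarrow> norm v \<le> b"
    using compact_imp_bounded[OF M] by (auto simp: bounded_iff)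
  have bsq: "(norm v)\<^sup>2 \<le> b\<^sup>2" if "v \<in> M" for v
    using b[OF that] by (intro power_mono) auto
  define S where "S = {\<phi> t v g |t v g. 0 \<le> t \<and> v \<in> M \<and> g \<in> Y}"
  have "uniformly_small_tails S"
    unfolding uniformly_small_tails_def
  proof (intro allI impI)
    fix e :: real
    assume e: "0 < e"
    then have "\<forall>\<^sub>F \<eta> in at_right 0. \<forall>v\<in>M. energy (cutoff \<eta>) v < e / 2"
      by (intro uniformly_small_tailsD compact_imp_uniformly_small_tails M) simp
    moreover have "\<forall>\<^sub>F \<eta> in at_right 0. \<forall>T\<ge>0. \<forall>v. \<forall>g\<in>Y. (norm v)\<^sup>2 \<le> b\<^sup>2 \<longrightarrow>
        energy (cutoff \<eta>) (\<phi> T v g) \<le> exp (- lam * T) * energy (cutoff \<eta>) v + e / 2"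
      using e by (intro eventually_tail_cocycle_le) simp
    ultimately show "\<forall>\<^sub>F \<eta> in at_right 0. \<forall>u\<in>S. energy (cutoff \<eta>) u < e"
    proof eventually_elim
      case (elim \<eta>)
      have "energy (cutoff \<eta>) (\<phi> t v g) < e" if t: "0 \<le> t" and v: "v \<in> M" and g: "g \<in> Y" for t v g
      proof -
        have "energy (cutoff \<eta>) (\<phi> t v g) \<le> exp (- lam * t) * energy (cutoff \<eta>) v + e / 2"
          using elim(2) t g bsq[OF v] by blast
        moreover have "exp (- lam * t) * energy (cutoff \<eta>) v \<le> 1 * energy (cutoff \<eta>) v"
          using t lam_pos by (intro mult_right_mono energy_nonneg unit_weight_cutoff) simp
        moreover have "energy (cutoff \<eta>) v < e / 2"
          using elim(1) v by blast
        ultimately show ?thesis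
          by linarith
      qed
      then show ?case
        unfolding S_def by blast
    qed
  qed
  moreover have "norm u \<le> sqrt (b\<^sup>2 + radius_sq)" if u: "u \<in> S" for u
  proof -
    obtain t v g where "u = \<phi> t v g" "0 \<le> t" "v \<in> M" "g \<in> Y"
      using u unfolding S_def by blast
    then have "(norm u)\<^sup>2 \<le> b\<^sup>2 + radius_sq"
      using norm_cocycle_le(2)[of g t v] bsq[of v] by simp
    then show ?thesis
      by (rule real_le_rsqrt)
  qed
  ultimately have "compact (closure S)"
    by (rule compact_closure_if_uniformly_small_tails[rotated])
  moreover have "\<phi> t v g \<in> closure S" if "0 \<le> t" "v \<in> M" "g \<in> Y" for t v g
    using that by (intro subsetD[OF closure_subset]) (auto simp: S_def)
  ultimately show ?thesis
    by blast
qed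

section \<open>Uniform bounds for backward orbits\<close>

lemma norm_backward_orbit_le:
  assumes g: "g \<in> Y" and c: "backward_orbit g c"
  shows "(norm (c n))\<^sup>2 \<le> radius_sq"
proof -
  \<comment> \<open>The bound \<open>b\<close> belongs to the individual orbit, but it is multiplied
    by \<open>exp (- lam * m)\<close> and disappears as the starting time recedes.\<close>
  have *: "(norm (c 0))\<^sup>2 \<le> radius_sq" if g: "g \<in> Y" and c: "backward_orbit g c" for g c
  proof -
    obtain N where N: "compact N" "range c \<subseteq> N"
      using c unfolding backward_orbit_def by blast
    obtain b where "\<forall>x\<in>N. norm x \<le> b"
      using compact_imp_bounded[OF N(1)] unfolding bounded_iff by (elim exE)
    with N(2) have "norm (c m) \<le> b" for m
      by blast
    then have b: "(norm (c m))\<^sup>2 \<le> b\<^sup>2" for m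
      by (intro power_mono) auto
    show ?thesis
    proof (rule le_if_le_exp_sequence[OF lam_pos])
      fix m
      have "(norm (c 0))\<^sup>2 \<le> exp (- lam * real m) * (norm (c m))\<^sup>2 + radius_sq"
        using norm_cocycle_le(1)[OF shift_forcing[OF g], of "real m" "c m" "- real m"]
        by (simp add: backward_orbit_apply[OF g c])
      also have "\<dots> \<le> exp (- lam * real m) * b\<^sup>2 + radius_sq"
        using b by simp
      finally show "(norm (c 0))\<^sup>2 \<le> exp (- lam * real m) * b\<^sup>2 + radius_sq" .
    qed
  qed
  show ?thesis
    using *[OF shift_forcing[OF g] backward_orbit_tail[OF g c, of n]] by simp
qed

text \<open>Past states need no small tails: their weighted energy is at most
  \<open>radius_sq\<close>, and this is damped over arbitrarily long times. Only the error
  \<open>e / 2\<close> survives at time 0.\<close>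

lemma backward_orbits_in_compact:
  "\<exists>K. compact K \<and> (\<forall>g\<in>Y. \<forall>c. backward_orbit g c \<longrightarrow> c 0 \<in> K)"
proof -
  define S where "S = {c 0 |g c. g \<in> Y \<and> backward_orbit g c}"
  have "uniformly_small_tails S"
    unfolding uniformly_small_tails_def
  proof (intro allI impI)
    fix e :: real
    assume e: "0 < e"
    then have "\<forall>\<^sub>F \<eta> in at_right 0. \<forall>T\<ge>0. \<forall>v. \<forall>g\<in>Y. (norm v)\<^sup>2 \<le> radius_sq \<longrightarrow>
        energy (cutoff \<eta>) (\<phi> T v g) \<le> exp (- lam * T) * energy (cutoff \<eta>) v + e / 2"
      by (intro eventually_tail_cocycle_le) simp
    then show "\<forall>\<^sub>F \<eta> in at_right 0. \<forall>u\<in>S. energy (cutoff \<eta>) u < e"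
    proof eventually_elim
      case (elim \<eta>)
      have "energy (cutoff \<eta>) (c 0) < e" if g: "g \<in> Y" and c: "backward_orbit g c" for g c
      proof -
        have "energy (cutoff \<eta>) (c 0) \<le> e / 2"
        proof (rule le_if_le_exp_sequence[OF lam_pos])
          fix m
          have "energy (cutoff \<eta>) (\<phi> (real m) (c m) (shift (- real m) g))
              \<le> exp (- lam * real m) * energy (cutoff \<eta>) (c m) + e / 2"
            using elim norm_backward_orbit_le[OF g c, of m] shift_forcing[OF g] by simp
          moreover have "energy (cutoff \<eta>) (c m) \<le> radius_sq"
            using energy_le_norm[OF unit_weight_cutoff] norm_backward_orbit_le[OF g c] by (rule order_trans)
          then have "exp (- lam * real m) * energy (cutoff \<eta>) (c m) \<le> exp (- lam * real m) * radius_sq"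
            by simp
          ultimately show "energy (cutoff \<eta>) (c 0) \<le> exp (- lam * real m) * radius_sq + e / 2"
            unfolding backward_orbit_apply[OF g c] by linarith
        qed
        then show ?thesis
          using e by simp
      qed
      then show ?case
        unfolding S_def by blast
    qed
  qed
  moreover have "norm u \<le> sqrt radius_sq" if "u \<in> S" for u
    using that norm_backward_orbit_le unfolding S_def by (auto intro: real_le_rsqrt)
  ultimately have "compact (closure S)"
    by (rule compact_closure_if_uniformly_small_tails[rotated])
  moreover have "c 0 \<in> closure S" if "g \<in> Y" "backward_orbit g c" for g c
    using that by (intro subsetD[OF closure_subset]) (auto simp: S_def)
  ultimately show ?thesis
    by blast
qed

lemma continuous_on_cocycle:
  assumes T: "0 \<le> T"
  shows "continuous_on (UNIV \<times> Y) (\<lambda>(v, g). \<phi> T v g)"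
  unfolding continuous_on_iff
proof (intro ballI allI impI)
  fix p :: "ell2 \<times> ell2 curve" and e :: real
  assume p: "p \<in> UNIV \<times> Y" and e: "0 < e"
  obtain v g where vg: "p = (v, g)" and g: "g \<in> Y"
    using p by auto
  \<comment> \<open>A ball that holds all trajectories starting within distance 1 of
    \<open>v\<close>; \<open>K\<close> must be fixed before the neighbourhood is chosen.\<close>
  define R where "R = sqrt ((norm v + 1)\<^sup>2 + radius_sq)"
  obtain K where K: "0 < K" "\<And>u1 u2 v1 v2 g1 g2 T d. lattice_solution \<nu> lam F v1 g1 u1 \<Longrightarrow>
    lattice_solution \<nu> lam F v2 g2 u2 \<Longrightarrow> 0 \<le> T \<Longrightarrow>
    \<forall>s\<in>{0..T}. norm (u1 s) \<le> R \<and> norm (u2 s) \<le> R \<and> dist (at_time g1 s) (at_time g2 s) \<le> d \<Longrightarrow>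
    (dist (u1 T) (u2 T))\<^sup>2 \<le> exp (K * T) * ((dist v1 v2)\<^sup>2 + d\<^sup>2)"
    using stability[of R] by metis
  have E: "1 \<le> exp (K * T)"
    using K(1) T by simp
  \<comment> \<open>With \<open>E = exp (K * T)\<close>, the squared distance is at most
    \<open>2 * E\<close> times the square of \<open>e / (2 * E)\<close>, that is
    \<open>e\<^sup>2 / (2 * E)\<close>.\<close>
  define d where "d = min 1 (e / (2 * exp (K * T)))"
  have d: "0 < d" "d \<le> 1" "d \<le> e / (2 * exp (K * T))"
    using e by (simp_all add: d_def)
  \<comment> \<open>The second bound lets the distance of two forcings control their values on
    \<open>{0..T}\<close>; \<open>T + 1\<close> keeps the window length positive for
    \<open>T = 0\<close>.\<close>
  define \<delta> where "\<delta> = min d (inverse (T + 1))"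
  have \<delta>: "0 < \<delta>"
    using d T by (simp add: \<delta>_def)
  have "dist (\<phi> T v' g') (\<phi> T v g) < e" if close: "dist (v', g') (v, g) < \<delta>" and g': "g' \<in> Y" for v' g'
  proof -
    have v': "dist v' v < d"
      using close dist_fst_le[of "(v', g')" "(v, g)"] by (simp add: \<delta>_def)
    have gg: "dist g' g < \<delta>"
      using close dist_snd_le[of "(v', g')" "(v, g)"] by simp
    obtain u where u: "lattice_solution \<nu> lam F v g u" "\<And>t. 0 \<le> t \<Longrightarrow> \<phi> t v g = u t"
      using cocycle_solution[OF g] by blast
    obtain u' where u': "lattice_solution \<nu> lam F v' g' u'" "\<And>t. 0 \<le> t \<Longrightarrow> \<phi> t v' g' = u' t"
      using cocycle_solution[OF g'] by blast
    have norm_le: "norm (\<phi> s w h) \<le> R" if "0 \<le> s" "norm w \<le> norm v + 1" "h \<in> Y" for s w h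
    proof -
      have "(norm w)\<^sup>2 \<le> (norm v + 1)\<^sup>2"
        using that(2) by (intro power_mono) auto
      then have "(norm (\<phi> s w h))\<^sup>2 \<le> (norm v + 1)\<^sup>2 + radius_sq"
        using norm_cocycle_le(2)[OF that(3,1), of w] by linarith
      then show ?thesis
        unfolding R_def by (rule real_le_rsqrt)
    qed
    have "norm v' \<le> norm v + 1"
      using v' d(2) norm_triangle_ineq2[of v' v] by (simp add: dist_norm)
    then have "\<forall>s\<in>{0..T}. norm (u' s) \<le> R \<and> norm (u s) \<le> R \<and> dist (at_time g' s) (at_time g s) \<le> d"
    proof (intro ballI conjI)
      fix s
      assume s: "s \<in> {0..T}"
      show "norm (u' s) \<le> R" "norm (u s) \<le> R"
        using norm_le[of s v' g'] norm_le[of s v g] s g g' u(2) u'(2) \<open>norm v' \<le> norm v + 1\<close> by auto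
      have "dist (at_time g' s) (at_time g s) < \<delta>"
        by (rule dist_at_time_less[OF gg, of "T + 1"]) (use s T in \<open>auto simp: \<delta>_def\<close>)
      then show "dist (at_time g' s) (at_time g s) \<le> d"
        by (simp add: \<delta>_def)
    qed
    from K(2)[OF u'(1) u(1) T this]
    have "(dist (u' T) (u T))\<^sup>2 \<le> exp (K * T) * ((dist v' v)\<^sup>2 + d\<^sup>2)" .
    also have "\<dots> \<le> exp (K * T) * (d\<^sup>2 + d\<^sup>2)"
      using v' by (intro mult_left_mono add_right_mono power_mono) auto
    also have "\<dots> \<le> exp (K * T) * (2 * (e / (2 * exp (K * T)))\<^sup>2)"
      using d by (simp add: power_mono)
    also have "\<dots> = e\<^sup>2 / (2 * exp (K * T))"
      by (simp add: power2_eq_square)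
    also have "\<dots> < e\<^sup>2"
    proof -
      have "1 < 2 * exp (K * T)"
        using E by linarith
      then show ?thesis
        using e by (simp add: divide_less_eq)
    qed
    finally have "dist (u' T) (u T) < e"
      by (rule power_less_imp_less_base) (use e in simp)
    then show ?thesis
      using u(2)[OF T] u'(2)[OF T] by simp
  qed
  then show "\<exists>d>0. \<forall>q\<in>UNIV \<times> Y. dist q p < d \<longrightarrow>
      dist (case q of (v, g) \<Rightarrow> \<phi> T v g) (case p of (v, g) \<Rightarrow> \<phi> T v g) < e"
    using \<delta> vg by (intro exI[of _ \<delta>]) auto
qed

sublocale asymptotically_compact_cocycle \<phi> Y shift
  by unfold_locales
    (use compact_forcing continuous_on_shift continuous_on_cocycle trajectories_in_compact
      backward_orbits_in_compact in blast)+

end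

theorem theorem5p4:
  fixes \<nu> lam \<alpha> :: real and F :: "real \<Rightarrow> real" and f :: "ell2 curve"
  assumes "\<nu> > 0" and "lam > 0" and "\<alpha> > 0"
    and "translation_compact f"
    and "continuous_on UNIV F"
    and "\<And>B. bounded B \<Longrightarrow> \<exists>K. K-lipschitz_on B F"
    and "F 0 = 0"
    and "\<And>s. s * F s \<le> - \<alpha> * s\<^sup>2"
  shows "\<exists>I. compact_global_attractor (lattice_cocycle \<nu> lam F) (curve_hull f) shift I"
proof -
  have "s * F s \<le> 0" for s
  proof -
    have "- \<alpha> * s\<^sup>2 \<le> 0"
      using \<open>\<alpha> > 0\<close> by simp
    then show ?thesis
      using assms(8)[of s] by linarith
  qed
  moreover have "compact (curve_hull f)"
    using \<open>translation_compact f\<close>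
    by (simp add: translation_compact_def precompact_def curve_hull_def)
  ultimately interpret forced_lattice_system \<nu> lam F "curve_hull f"
    using assms shift_in_curve_hull by unfold_locales auto
  show ?thesis
    by (rule exI[of _ attractor], rule compact_global_attractor)
qed

end
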